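(* Assume that $g$ is globally Lipschitz continuous on $\mathbb{R}$ with constant $\ell_g>0$, that $g$ is globally bounded by a constant $a>0$, that $g'$ is globally Lipschitz continuous with constant $k_1>0$, and that $k_2=|g'(0)|>0$. Let $K>0$ be such that $\sup\{\rho(x);\ |x-y|\leqslant 1\}\leqslant K\rho(y)$ for all $y\in\mathbb{R}^N$. Let $\{h_\epsilon\}_{\epsilon\in[0,1]}$ be a family of functions $h_\epsilon:\mathbb{R}^2\to\mathbb{R}$, each satisfying the assumptions on $h$ listed in the context, such that $h_\epsilon\to h_0$ uniformly on $\mathbb{R}^2$ as $\epsilon\to0^+$. For $\epsilon\in[0,1]$ let $S_\epsilon(t,\tau)$ be the process in $L^2(\mathbb{R}^N,\rho)$ associated with $h=h_\epsilon$, and let $\{\mathcal{A}_\epsilon(t);\ t\in\mathbb{R}\}$ be its pullback attractor. Then the family of pullback attractors is upper semicontinuous at $\epsilon=0$, i.e. for each $t\in\mathbb{R}$ $$\lim_{\epsilon\to0^+}\mathrm{dist}(\mathcal{A}_\epsilon(t),\mathcal{A}_0(t))=0.$$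
   Context: Weighted space: $N\geqslant 1$; $\rho$ is a positive continuous function on $\mathbb{R}^N$ with $\int_{\mathbb{R}^N}\rho\,dx=1$; $L^2(\mathbb{R}^N,\rho)$ is the space of $u\in L^1_{loc}(\mathbb{R}^N)$ with $\|u\|_{L^2(\mathbb{R}^N,\rho)}=\left(\int_{\mathbb{R}^N}\rho(x)|u(x)|^2 dx\right)^{1/2}<+\infty$. Equation: $\beta>1$; $J:\mathbb{R}^N\to\mathbb{R}$ is a nonnegative even function of class $\mathcal{C}^1$ with integral $1$, supported in the ball of radius $1$ centered at the origin; $(J*u)(x)=\int_{\mathbb{R}^N}J(x-y)u(y)dy$; $g:\mathbb{R}\to\mathbb{R}$ is of class $\mathcal{C}^1$ with $g(0)=0$. Assumptions on $h:\mathbb{R}^2\to\mathbb{R}$: $0\leqslant h(t,s)<h^*$ for all $(t,s)\in\mathbb{R}^2$, where $h^*>0$ is a constant such that, for $0\leqslant h<h^*$, the equation $s=\tanh(\beta s+\beta h(\cdot,s))$ has three and only three different roots $s\in[-1,1]$; for all $t\in\mathbb{R}$, $h(t,\cdot)$ is of class $\mathcal{C}^1$, is Lipschitz with a constant $\ell_h>0$ independent of $t$, and $h(t,0)=0$. Process: for $\tau\in\mathbb{R}$ and $u_\tau\in L^2(\mathbb{R}^N,\rho)$ the Cauchy problem $\partial_t u=-u+g(\beta (J*u)+\beta h(t,u))$, $u(\tau,\cdot)=u_\tau$, is understood to have a unique global solution $u\in \mathcal{C}([\tau,\infty),L^2(\mathbb{R}^N,\rho))\cap\mathcal{C}^1((\tau,\infty),L^2(\mathbb{R}^N,\rho))$;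 the process associated with $h$ is $S(t,\tau)u_\tau:=u(t,\cdot)$ for $t\geqslant\tau$. The solution satisfies $u(t,x)=e^{-(t-\tau)}u_\tau(x)+\int_\tau^t e^{-(t-s)}g(\beta(J*u)(s,x)+\beta h(s,u(s,x)))ds$. Definitions: for subsets $A,B$, $\mathrm{dist}(A,B)=\sup_{a\in A}\inf_{b\in B}\|a-b\|_{L^2(\mathbb{R}^N,\rho)}$ (Hausdorff semi-distance). A family $\{K(t);\ t\in\mathbb{R}\}$ pullback attracts bounded sets if for every $t\in\mathbb{R}$ and every bounded set $C$, $\lim_{\tau\to-\infty}\mathrm{dist}(S(t,\tau)C,K(t))=0$. A family $\{\mathcal{A}(t);\ t\in\mathbb{R}\}$ of compact sets is the pullback attractor of $S$ if it is invariant ($S(t,\tau)\mathcal{A}(\tau)=\mathcal{A}(t)$ for all $t\geqslant\tau$), pullback attracts bounded sets, and is minimal: if $\{C(t);\ t\in\mathbb{R}\}$ is a family of closed sets which pullback attracts bounded sets, then $\mathcal{A}(t)\subset C(t)$ for all $t\in\mathbb{R}$. Under the stated hypotheses the paper shows the pullback attractor exists and equals $\mathcal{A}(t)=\bigcap_{s\leqslant t}\overline{\bigcup_{\tau\leqslant s}S(t,\tau)B(0;a+\delta)}$ for $\delta>0$, where $B(0;r)$ is the ball of radius $r$ centered at $0$ in $L^2(\mathbb{R}^N,\rho)$. *)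

theory Defs
  imports "HOL-Analysis.Analysis"
begin

section \<open>Measurable functions up to equality almost everywhere\<close>

text \<open>
  The elements of a Lebesgue space are classes of functions. The type below does not depend on the
  weight, so that weighted spaces are subsets of one real vector space. Every Lebesgue measurable
  function agrees almost everywhere with a Borel one, so Borel representatives lose no class.
\<close>

definition ae_eq :: "('a::euclidean_space \<Rightarrow> real) \<Rightarrow> ('a \<Rightarrow> real) \<Rightarrow> bool" where
  "ae_eq f g \<longleftrightarrow> f \<in> borel_measurable lborel \<and> g \<in> borel_measurable lborel \<and>
     (AE x in lborel. f x = g x)"

lemma part_equivp_ae_eq: "part_equivp (ae_eq :: ('a::euclidean_space \<Rightarrow> real) \<Rightarrow> _)"
proof (rule part_equivpI)
  show "\<exists>f::'a \<Rightarrow> real. ae_eq f f"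
    by (rule exI[of _ "\<lambda>_. 0"]) (simp add: ae_eq_def)
  show "symp (ae_eq :: ('a \<Rightarrow> real) \<Rightarrow> _)"
    by (auto simp: symp_def ae_eq_def)
  show "transp (ae_eq :: ('a \<Rightarrow> real) \<Rightarrow> _)"
    unfolding transp_def ae_eq_def by (auto elim: AE_mp)
qed

quotient_type (overloaded) 'a ae_fun = "'a::euclidean_space \<Rightarrow> real" / partial: ae_eq
  by (rule part_equivp_ae_eq)

instantiation ae_fun :: (euclidean_space) real_vector
begin

lift_definition zero_ae_fun :: "'a ae_fun" is "\<lambda>_. 0"
  by (simp add: ae_eq_def)

lift_definition plus_ae_fun :: "'a ae_fun \<Rightarrow> 'a ae_fun \<Rightarrow> 'a ae_fun" is "\<lambda>f g x. f x + g x"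
  unfolding ae_eq_def by (auto elim!: AE_mp)

lift_definition minus_ae_fun :: "'a ae_fun \<Rightarrow> 'a ae_fun \<Rightarrow> 'a ae_fun" is "\<lambda>f g x. f x - g x"
  unfolding ae_eq_def by (auto elim!: AE_mp)

lift_definition uminus_ae_fun :: "'a ae_fun \<Rightarrow> 'a ae_fun" is "\<lambda>f x. - f x"
  unfolding ae_eq_def by (auto elim!: AE_mp)

lift_definition scaleR_ae_fun :: "real \<Rightarrow> 'a ae_fun \<Rightarrow> 'a ae_fun" is "\<lambda>c f x. c * f x"
  unfolding ae_eq_def by (auto elim!: AE_mp)

instance
  by standard (transfer; simp add: ae_eq_def algebra_simps)+

end

text \<open>
  \<^term>\<open>rep_ae_fun u\<close> is some (Borel) representative of the class \<^term>\<open>u\<close>; for a Borel function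
  \<^term>\<open>f\<close>, \<^term>\<open>abs_ae_fun f\<close> is its class.
\<close>

lemma ae_eq_rep_refl: "ae_eq (rep_ae_fun u) (rep_ae_fun u)"
  by (rule Quotient3_rep_reflp[OF Quotient3_ae_fun])

lemma rep_ae_fun_measurable [measurable]: "rep_ae_fun u \<in> borel_measurable borel"
  using ae_eq_rep_refl[of u] by (simp add: ae_eq_def)

lemma rep_abs_ae_fun:
  assumes "f \<in> borel_measurable borel"
  shows "AE x in lborel. rep_ae_fun (abs_ae_fun f) x = f x"
proof -
  have "ae_eq f f" using assms by (simp add: ae_eq_def)
  then have "ae_eq (rep_ae_fun (abs_ae_fun f)) f"
    by (rule rep_abs_rsp_left[OF Quotient3_ae_fun])
  then show ?thesis by (simp add: ae_eq_def)
qed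

lemma ae_fun_eq_iff: "u = v \<longleftrightarrow> (AE x in lborel. rep_ae_fun u x = rep_ae_fun v x)"
proof -
  have "u = v \<longleftrightarrow> ae_eq (rep_ae_fun u) (rep_ae_fun v)"
    by (rule Quotient3_rel_rep[OF Quotient3_ae_fun, symmetric])
  then show ?thesis by (simp add: ae_eq_def)
qed

lemma rep_zero_ae: "AE x in lborel. rep_ae_fun (0 :: 'a::euclidean_space ae_fun) x = 0"
  unfolding zero_ae_fun_def by (rule rep_abs_ae_fun) simp

lemma rep_minus_ae: "AE x in lborel. rep_ae_fun (u - v) x = rep_ae_fun u x - rep_ae_fun v x"
proof -
  have "u - v = abs_ae_fun (\<lambda>x. rep_ae_fun u x - rep_ae_fun v x)"
    by (simp add: minus_ae_fun_def)
  then show ?thesis using rep_abs_ae_fun[of "\<lambda>x. rep_ae_fun u x - rep_ae_fun v x"] by simp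
qed


section \<open>The weighted space\<close>

definition weight :: "('a::euclidean_space \<Rightarrow> real) \<Rightarrow> bool" where
  "weight \<rho> \<longleftrightarrow> continuous_on UNIV \<rho> \<and> (\<forall>x. 0 < \<rho> x) \<and>
     integrable lborel \<rho> \<and> (LINT x|lborel. \<rho> x) = 1"

definition L1_loc :: "'a::euclidean_space ae_fun set" where
  "L1_loc = {u. \<forall>C. compact C \<longrightarrow> set_integrable lborel C (rep_ae_fun u)}"

definition L2 :: "('a::euclidean_space \<Rightarrow> real) \<Rightarrow> 'a ae_fun set" where
  "L2 \<rho> = {u \<in> L1_loc. integrable lborel (\<lambda>x. \<rho> x * \<bar>rep_ae_fun u x\<bar>\<^sup>2)}"

definition norm2 :: "('a::euclidean_space \<Rightarrow> real) \<Rightarrow> 'a ae_fun \<Rightarrow> real" where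
  "norm2 \<rho> u = sqrt (LINT x|lborel. \<rho> x * \<bar>rep_ae_fun u x\<bar>\<^sup>2)"

definition dist2 :: "('a::euclidean_space \<Rightarrow> real) \<Rightarrow> 'a ae_fun \<Rightarrow> 'a ae_fun \<Rightarrow> real" where
  "dist2 \<rho> u v = norm2 \<rho> (u - v)"

abbreviation top2 :: "('a::euclidean_space \<Rightarrow> real) \<Rightarrow> 'a ae_fun topology" where
  "top2 \<rho> \<equiv> Metric_space.mtopology (L2 \<rho>) (dist2 \<rho>)"

abbreviation bounded2 :: "('a::euclidean_space \<Rightarrow> real) \<Rightarrow> 'a ae_fun set \<Rightarrow> bool" where
  "bounded2 \<rho> \<equiv> Metric_space.mbounded (L2 \<rho>) (dist2 \<rho>)"

lemma weight_measurable: "weight \<rho> \<Longrightarrow> \<rho> \<in> borel_measurable borel"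
  by (auto simp: weight_def intro: borel_measurable_continuous_onI)

lemma diff_in_L2:
  assumes \<rho>: "weight \<rho>" and "u \<in> L2 \<rho>" "v \<in> L2 \<rho>"
  shows "u - v \<in> L2 \<rho>"
proof -
  note [measurable] = weight_measurable[OF \<rho>]
  have pos: "0 < \<rho> x" for x using \<rho> by (simp add: weight_def)
  have "set_integrable lborel C (rep_ae_fun (u - v))" if "compact C" for C
  proof -
    have [measurable]: "C \<in> sets borel" using that by (simp add: borel_compact)
    have "set_integrable lborel C (\<lambda>x. rep_ae_fun u x - rep_ae_fun v x)"
      using assms that by (intro set_integral_diff) (auto simp: L2_def L1_loc_def)
    then show ?thesis
      unfolding set_integrable_def
      by (rule integrable_cong_AE_imp) (use rep_minus_ae[of u v] in \<open>auto elim!: AE_mp\<close>)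
  qed
  moreover have "integrable lborel (\<lambda>x. \<rho> x * \<bar>rep_ae_fun (u - v) x\<bar>\<^sup>2)"
  proof (rule Bochner_Integration.integrable_bound)
    show "integrable lborel (\<lambda>x. 2 * (\<rho> x * \<bar>rep_ae_fun u x\<bar>\<^sup>2) + 2 * (\<rho> x * \<bar>rep_ae_fun v x\<bar>\<^sup>2))"
      using assms by (auto simp: L2_def)
    show "AE x in lborel. norm (\<rho> x * \<bar>rep_ae_fun (u - v) x\<bar>\<^sup>2)
        \<le> norm (2 * (\<rho> x * \<bar>rep_ae_fun u x\<bar>\<^sup>2) + 2 * (\<rho> x * \<bar>rep_ae_fun v x\<bar>\<^sup>2))"
      using rep_minus_ae[of u v]
    proof (eventually_elim)
      case (elim x)
      define a b where "a = rep_ae_fun u x" and "b = rep_ae_fun v x"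
      have "(a - b)\<^sup>2 \<le> 2 * a\<^sup>2 + 2 * b\<^sup>2"
        using zero_le_power2[of "a + b"] by (simp add: power2_eq_square algebra_simps)
      then have "\<rho> x * (a - b)\<^sup>2 \<le> \<rho> x * (2 * a\<^sup>2 + 2 * b\<^sup>2)"
        using pos[of x] by (intro mult_left_mono) auto
      moreover have "rep_ae_fun (u - v) x = a - b"
        using elim by (simp add: a_def b_def)
      moreover have "0 \<le> 2 * (\<rho> x * \<bar>a\<bar>\<^sup>2) + 2 * (\<rho> x * \<bar>b\<bar>\<^sup>2)" "0 \<le> \<rho> x * \<bar>a - b\<bar>\<^sup>2"
        using pos[of x] by simp_all
      ultimately show ?case
        by (simp add: a_def[symmetric] b_def[symmetric] distrib_left mult.left_commute)
    qed
  qed measurable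
  ultimately show ?thesis by (simp add: L2_def L1_loc_def)
qed

lemma Metric_space_L2:
  assumes \<rho>: "weight \<rho>"
  shows "Metric_space (L2 \<rho>) (dist2 \<rho>)"
proof
  note [measurable] = weight_measurable[OF \<rho>]
  have pos: "0 < \<rho> x" for x using \<rho> by (simp add: weight_def)
  have pos': "0 \<le> \<rho> x" for x using pos[of x] by simp
  have int_nn: "0 \<le> (LINT x|lborel. \<rho> x * \<bar>rep_ae_fun u x\<bar>\<^sup>2)" for u
    using pos' by (intro integral_nonneg_AE) auto
  fix u v w :: "'a ae_fun"
  show "0 \<le> dist2 \<rho> u v"
    using int_nn by (simp add: dist2_def norm2_def)
  have "(LINT x|lborel. \<rho> x * \<bar>rep_ae_fun (u - v) x\<bar>\<^sup>2) = (LINT x|lborel. \<rho> x * \<bar>rep_ae_fun (v - u) x\<bar>\<^sup>2)"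
    using rep_minus_ae[of u v] rep_minus_ae[of v u]
    by (intro integral_cong_AE) (auto elim!: AE_mp simp: power2_commute)
  then show "dist2 \<rho> u v = dist2 \<rho> v u" by (simp add: dist2_def norm2_def)
  assume u: "u \<in> L2 \<rho>" and v: "v \<in> L2 \<rho>"
  have int: "integrable lborel (\<lambda>x. \<rho> x * \<bar>rep_ae_fun (u - v) x\<bar>\<^sup>2)"
    using diff_in_L2[OF \<rho> u v] by (simp add: L2_def)
  have "dist2 \<rho> u v = 0 \<longleftrightarrow> (AE x in lborel. \<rho> x * \<bar>rep_ae_fun (u - v) x\<bar>\<^sup>2 = 0)"
    using integral_nonneg_eq_0_iff_AE[OF int] pos' by (simp add: dist2_def norm2_def)
  also have "\<dots> \<longleftrightarrow> (AE x in lborel. rep_ae_fun (u - v) x = 0)"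
    using pos by (simp add: less_imp_neq[symmetric] order.strict_implies_not_eq)
  also have "\<dots> \<longleftrightarrow> (AE x in lborel. rep_ae_fun u x = rep_ae_fun v x)"
    using rep_minus_ae[of u v] by (auto elim!: AE_mp)
  also have "\<dots> \<longleftrightarrow> u = v" by (simp add: ae_fun_eq_iff)
  finally show "dist2 \<rho> u v = 0 \<longleftrightarrow> u = v" .
  assume w: "w \<in> L2 \<rho>"
  define I where "I z = (LINT x|lborel. \<rho> x * \<bar>rep_ae_fun z x\<bar>\<^sup>2)" for z :: "'a ae_fun"
  define A B where "A = dist2 \<rho> u v" and "B = dist2 \<rho> v w"
  have nn: "A \<ge> 0" "B \<ge> 0" using int_nn by (simp_all add: A_def B_def dist2_def norm2_def)
  have IA: "I (u - v) = A\<^sup>2" "I (v - w) = B\<^sup>2"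
    using int_nn by (simp_all add: A_def B_def dist2_def norm2_def I_def)
  have iA: "integrable lborel (\<lambda>x. \<rho> x * \<bar>rep_ae_fun (u - v) x\<bar>\<^sup>2)"
    and iB: "integrable lborel (\<lambda>x. \<rho> x * \<bar>rep_ae_fun (v - w) x\<bar>\<^sup>2)"
    and iC: "integrable lborel (\<lambda>x. \<rho> x * \<bar>rep_ae_fun (u - w) x\<bar>\<^sup>2)"
    using diff_in_L2[OF \<rho>] u v w by (auto simp: L2_def)
  show "dist2 \<rho> u w \<le> dist2 \<rho> u v + dist2 \<rho> v w"
  proof (rule field_le_epsilon)
    fix e :: real assume "0 < e"
    define p q where "p = A + e / 2" and "q = B + e / 2"
    have p: "0 < p" "A \<le> p" and q: "0 < q" "B \<le> q"
      using nn \<open>0 < e\<close> by (auto simp: p_def q_def)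
    have young: "(a + b)\<^sup>2 \<le> (p + q) / p * a\<^sup>2 + (p + q) / q * b\<^sup>2" for a b :: real
    proof -
      have "(p + q) / p * a\<^sup>2 + (p + q) / q * b\<^sup>2 - (a + b)\<^sup>2 = (q * a - p * b)\<^sup>2 / (p * q)"
        using p q by (simp add: field_simps power2_eq_square)
      moreover have "0 \<le> (q * a - p * b)\<^sup>2 / (p * q)" using p q by simp
      ultimately show ?thesis by linarith
    qed
    have "I (u - w) \<le> (LINT x|lborel. (p + q) / p * (\<rho> x * \<bar>rep_ae_fun (u - v) x\<bar>\<^sup>2)
        + (p + q) / q * (\<rho> x * \<bar>rep_ae_fun (v - w) x\<bar>\<^sup>2))"
      unfolding I_def
    proof (rule integral_mono_AE[OF iC])
      show "integrable lborel (\<lambda>x. (p + q) / p * (\<rho> x * \<bar>rep_ae_fun (u - v) x\<bar>\<^sup>2)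
          + (p + q) / q * (\<rho> x * \<bar>rep_ae_fun (v - w) x\<bar>\<^sup>2))"
        using iA iB by auto
      show "AE x in lborel. \<rho> x * \<bar>rep_ae_fun (u - w) x\<bar>\<^sup>2
          \<le> (p + q) / p * (\<rho> x * \<bar>rep_ae_fun (u - v) x\<bar>\<^sup>2)
          + (p + q) / q * (\<rho> x * \<bar>rep_ae_fun (v - w) x\<bar>\<^sup>2)"
        using rep_minus_ae[of u v] rep_minus_ae[of v w] rep_minus_ae[of u w]
      proof eventually_elim
        case (elim x)
        have "rep_ae_fun (u - w) x = rep_ae_fun (u - v) x + rep_ae_fun (v - w) x"
          using elim by simp
        then show ?case
          using mult_left_mono[OF young[of "rep_ae_fun (u - v) x" "rep_ae_fun (v - w) x"] pos'[of x]]
          by (simp add: algebra_simps)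
      qed
    qed
    also have "\<dots> = (p + q) / p * A\<^sup>2 + (p + q) / q * B\<^sup>2"
      using iA iB IA by (simp add: I_def)
    also have "\<dots> \<le> (p + q) / p * p\<^sup>2 + (p + q) / q * q\<^sup>2"
      using p q nn by (intro add_mono mult_left_mono power_mono) auto
    also have "\<dots> = (p + q)\<^sup>2"
      using p q by (simp add: field_simps power2_eq_square)
    finally have "sqrt (I (u - w)) \<le> p + q"
      using p q by (simp add: real_le_lsqrt)
    then show "dist2 \<rho> u w \<le> dist2 \<rho> u v + dist2 \<rho> v w + e"
      by (simp add: I_def dist2_def norm2_def p_def q_def A_def B_def)
  qed
qed

text \<open>
  With values in the extended nonnegative reals, so that the supremum over an empty set is 0 and
  the infimum over an empty set (like the supremum of an unbounded set) is infinite.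
\<close>

definition semidist :: "('a::euclidean_space \<Rightarrow> real) \<Rightarrow> 'a ae_fun set \<Rightarrow> 'a ae_fun set \<Rightarrow> ennreal"
  where "semidist \<rho> A B = (SUP a\<in>A. INF b\<in>B. ennreal (norm2 \<rho> (a - b)))"


section \<open>The nonlocal equation\<close>

definition conv_kernel :: "('a::euclidean_space \<Rightarrow> real) \<Rightarrow> bool" where
  "conv_kernel J \<longleftrightarrow> (\<forall>x. 0 \<le> J x) \<and> (\<forall>x. J (- x) = J x) \<and>
     (\<exists>J' :: 'a \<Rightarrow> 'a \<Rightarrow>\<^sub>L real. (\<forall>x. (J has_derivative blinfun_apply (J' x)) (at x)) \<and>
        continuous_on UNIV J') \<and>
     closure {x. J x \<noteq> 0} \<subseteq> cball 0 1 \<and>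
     integrable lborel J \<and> (LINT x|lborel. J x) = 1"

definition conv :: "('a::euclidean_space \<Rightarrow> real) \<Rightarrow> 'a ae_fun \<Rightarrow> 'a \<Rightarrow> real" where
  "conv J u x = (LINT y|lborel. J (x - y) * rep_ae_fun u y)"

text \<open>
  The three-root condition concerns the given function: for each \<open>t\<close> the equation
  \<open>s = tanh (\<beta> * s + \<beta> * h t s)\<close> in the unknown \<open>s\<close>. (No bound on \<open>h\<close> alone could give it, since
  \<open>h t\<close> may oscillate.)
\<close>

definition admissible :: "real \<Rightarrow> (real \<Rightarrow> real \<Rightarrow> real) \<Rightarrow> bool" where
  "admissible \<beta> h \<longleftrightarrow>
     (\<exists>hstar>0. (\<forall>t s. 0 \<le> h t s \<and> h t s < hstar) \<and>
        (\<forall>t. card {s \<in> {-1..1}. s = tanh (\<beta> * s + \<beta> * h t s)} = 3)) \<and>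
     (\<forall>t. h t C1_differentiable_on UNIV) \<and>
     (\<exists>lh>0. \<forall>t. lh-lipschitz_on UNIV (h t)) \<and>
     (\<forall>t. h t 0 = 0)"

definition rhs ::
  "('a::euclidean_space \<Rightarrow> real) \<Rightarrow> real \<Rightarrow> (real \<Rightarrow> real) \<Rightarrow> (real \<Rightarrow> real \<Rightarrow> real) \<Rightarrow>
   real \<Rightarrow> 'a ae_fun \<Rightarrow> 'a ae_fun" where
  "rhs J \<beta> g h t u =
     - u + abs_ae_fun (\<lambda>x. g (\<beta> * conv J u x + \<beta> * h t (rep_ae_fun u x)))"

text \<open>
  \<^term>\<open>top2 \<rho>\<close> carries only the points of \<^term>\<open>L2 \<rho>\<close>, so the continuity conditions include
  that the curve and its derivative take values there.
\<close>

definition solution ::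
  "('a::euclidean_space \<Rightarrow> real) \<Rightarrow> ('a \<Rightarrow> real) \<Rightarrow> real \<Rightarrow> (real \<Rightarrow> real) \<Rightarrow>
   (real \<Rightarrow> real \<Rightarrow> real) \<Rightarrow> real \<Rightarrow> 'a ae_fun \<Rightarrow> (real \<Rightarrow> 'a ae_fun) \<Rightarrow> bool" where
  "solution \<rho> J \<beta> g h \<tau> u\<tau> u \<longleftrightarrow>
     u \<tau> = u\<tau> \<and>
     continuous_map (top_of_set {\<tau>..}) (top2 \<rho>) u \<and>
     (\<exists>u'. continuous_map (top_of_set {\<tau><..}) (top2 \<rho>) u' \<and>
        (\<forall>t>\<tau>. ((\<lambda>s. norm2 \<rho> ((u s - u t) /\<^sub>R (s - t) - u' t)) \<longlongrightarrow> 0) (at t)) \<and>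
        (\<forall>t>\<tau>. u' t = rhs J \<beta> g h t (u t)))"

text \<open>
  \<open>h\<close> carries no regularity in \<open>t\<close>, so existence of solutions is part of being given a process.
\<close>

definition is_process ::
  "('a::euclidean_space \<Rightarrow> real) \<Rightarrow> ('a \<Rightarrow> real) \<Rightarrow> real \<Rightarrow> (real \<Rightarrow> real) \<Rightarrow>
   (real \<Rightarrow> real \<Rightarrow> real) \<Rightarrow> (real \<Rightarrow> real \<Rightarrow> 'a ae_fun \<Rightarrow> 'a ae_fun) \<Rightarrow> bool" where
  "is_process \<rho> J \<beta> g h S \<longleftrightarrow>
     (\<forall>\<tau>. \<forall>u\<tau> \<in> L2 \<rho>.
        solution \<rho> J \<beta> g h \<tau> u\<tau> (\<lambda>t. S t \<tau> u\<tau>) \<and>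
        (\<forall>v. solution \<rho> J \<beta> g h \<tau> u\<tau> v \<longrightarrow> (\<forall>t\<ge>\<tau>. v t = S t \<tau> u\<tau>)))"


section \<open>Pullback attractors\<close>

definition pullback_attracts_bounded ::
  "('a::euclidean_space \<Rightarrow> real) \<Rightarrow> (real \<Rightarrow> real \<Rightarrow> 'a ae_fun \<Rightarrow> 'a ae_fun) \<Rightarrow>
   (real \<Rightarrow> 'a ae_fun set) \<Rightarrow> bool" where
  "pullback_attracts_bounded \<rho> S K \<longleftrightarrow>
     (\<forall>t C. bounded2 \<rho> C \<longrightarrow> ((\<lambda>\<tau>. semidist \<rho> (S t \<tau> ` C) (K t)) \<longlongrightarrow> 0) at_bot)"

definition is_pullback_attractor ::
  "('a::euclidean_space \<Rightarrow> real) \<Rightarrow> (real \<Rightarrow> real \<Rightarrow> 'a ae_fun \<Rightarrow> 'a ae_fun) \<Rightarrow>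
   (real \<Rightarrow> 'a ae_fun set) \<Rightarrow> bool" where
  "is_pullback_attractor \<rho> S A \<longleftrightarrow>
     (\<forall>t. compactin (top2 \<rho>) (A t)) \<and>
     (\<forall>\<tau> t. \<tau> \<le> t \<longrightarrow> S t \<tau> ` A \<tau> = A t) \<and>
     pullback_attracts_bounded \<rho> S A \<and>
     (\<forall>C. (\<forall>t. closedin (top2 \<rho>) (C t)) \<and> pullback_attracts_bounded \<rho> S C \<longrightarrow>
        (\<forall>t. A t \<subseteq> C t))"

end

theory Submission
  imports Defs
begin

text \<open>
  Since \<open>|g| \<le> a\<close>, the equation \<open>u' = - u + reaction\<close> pulls every solution into any ball around 0 of
  radius larger than \<open>a\<close>, at a rate that depends on no parameter (\<open>solution_norm2_le\<close>). A closed ball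
  of radius \<open>a + 1\<close> therefore pullback attracts bounded sets, and minimality of the attractor puts all
  the sets \<open>\<A> \<epsilon> \<tau>\<close> into this one ball \<open>B\<close> (\<open>pullback_attractor_subset_ball\<close>).

  Given a time \<open>t\<close> and a tolerance \<open>e\<close>, fix an initial time \<open>\<tau>\<close> so early that the unperturbed process
  carries \<open>B\<close> from \<open>\<tau>\<close> to within \<open>e/2\<close> of \<open>\<A> 0 t\<close>. On the now fixed interval from \<open>\<tau>\<close> to \<open>t\<close>,
  the perturbed and the unperturbed solution with equal data differ by at most a constant times
  \<open>sup |h \<epsilon> - h 0|\<close>, whatever the data (\<open>solution_diff_le\<close>). Invariance writes each point of \<open>\<A> \<epsilon> t\<close> as
  \<open>S \<epsilon> t \<tau> u\<close> with \<open>u\<close> in \<open>B\<close>; it is then within \<open>e/2\<close> of \<open>S 0 t \<tau> u\<close>, which is within \<open>e/2\<close> of \<open>\<A> 0 t\<close>.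

  Both estimates are Gronwall arguments for the norm of a curve. The norm need not be differentiable
  in time, but differentiability of the curve bounds its difference quotients from the left
  (\<open>norm2_left_growth\<close>), and such a one-sided bound is enough for comparison with exponentials
  (\<open>comparison_left_growth\<close>). The Lipschitz bound on the reaction term rests on boundedness of the
  convolution on the weighted space (\<open>conv_weighted_bound\<close>), the place where the growth condition on
  the weight enters.
\<close>

section \<open>The weighted space as a normed space\<close>

lemma weight_pos: "weight \<rho> \<Longrightarrow> 0 < \<rho> x"
  by (simp add: weight_def)

lemma nn_integral_weight: "weight \<rho> \<Longrightarrow> (\<integral>\<^sup>+x. ennreal (\<rho> x) \<partial>lborel) = 1"
  by (subst nn_integral_eq_integral) (auto simp: weight_def intro: less_imp_le)

lemma rep_scaleR_ae: "AE x in lborel. rep_ae_fun (c *\<^sub>R u) x = c * rep_ae_fun u x"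
proof -
  have "c *\<^sub>R u = abs_ae_fun (\<lambda>x. c * rep_ae_fun u x)"
    by (simp add: scaleR_ae_fun_def)
  then show ?thesis using rep_abs_ae_fun[of "\<lambda>x. c * rep_ae_fun u x"] by simp
qed

lemma zero_in_L2:
  assumes \<rho>: "weight \<rho>"
  shows "0 \<in> L2 \<rho>"
proof -
  note [measurable] = weight_measurable[OF \<rho>]
  have "set_integrable lborel C (rep_ae_fun 0)" if "compact C" for C :: "'a set"
  proof -
    have [measurable]: "C \<in> sets borel" using that by (simp add: borel_compact)
    show ?thesis
      unfolding set_integrable_def
      by (rule integrable_cong_AE_imp[OF integrable_zero]) (use rep_zero_ae in \<open>auto elim!: AE_mp\<close>)
  qed
  moreover have "integrable lborel (\<lambda>x. \<rho> x * \<bar>rep_ae_fun 0 x\<bar>\<^sup>2)"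
    by (rule integrable_cong_AE_imp[OF integrable_zero]) (use rep_zero_ae in \<open>auto elim!: AE_mp\<close>)
  ultimately show ?thesis by (simp add: L2_def L1_loc_def)
qed

lemma uminus_in_L2: "weight \<rho> \<Longrightarrow> u \<in> L2 \<rho> \<Longrightarrow> - u \<in> L2 \<rho>"
  using diff_in_L2[of \<rho> 0 u] zero_in_L2[of \<rho>] by simp

lemma plus_in_L2: "weight \<rho> \<Longrightarrow> u \<in> L2 \<rho> \<Longrightarrow> v \<in> L2 \<rho> \<Longrightarrow> u + v \<in> L2 \<rho>"
  using diff_in_L2[of \<rho> u "- v"] uminus_in_L2[of \<rho> v] by simp

lemma scaleR_in_L2:
  assumes \<rho>: "weight \<rho>" and u: "u \<in> L2 \<rho>"
  shows "c *\<^sub>R u \<in> L2 \<rho>"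
proof -
  note [measurable] = weight_measurable[OF \<rho>]
  have "set_integrable lborel C (rep_ae_fun (c *\<^sub>R u))" if "compact C" for C
  proof -
    have [measurable]: "C \<in> sets borel" using that by (simp add: borel_compact)
    have "set_integrable lborel C (\<lambda>x. c * rep_ae_fun u x)"
      using u that by (intro set_integrable_mult_right) (auto simp: L2_def L1_loc_def)
    then show ?thesis
      unfolding set_integrable_def
      by (rule integrable_cong_AE_imp) (use rep_scaleR_ae[of c u] in \<open>auto elim!: AE_mp\<close>)
  qed
  moreover have "integrable lborel (\<lambda>x. c\<^sup>2 * (\<rho> x * \<bar>rep_ae_fun u x\<bar>\<^sup>2))"
    using u by (auto simp: L2_def)
  then have "integrable lborel (\<lambda>x. \<rho> x * \<bar>rep_ae_fun (c *\<^sub>R u) x\<bar>\<^sup>2)"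
    by (rule integrable_cong_AE_imp)
      (use rep_scaleR_ae[of c u] in \<open>auto elim!: AE_mp simp: power_mult_distrib\<close>)
  ultimately show ?thesis by (simp add: L2_def L1_loc_def)
qed

lemma norm2_nonneg: "weight \<rho> \<Longrightarrow> 0 \<le> norm2 \<rho> u"
  unfolding norm2_def using weight_pos[of \<rho>]
  by (auto intro!: integral_nonneg_AE simp: less_imp_le)

lemma norm2_scaleR: "weight \<rho> \<Longrightarrow> norm2 \<rho> (c *\<^sub>R u) = \<bar>c\<bar> * norm2 \<rho> u"
proof -
  assume \<rho>: "weight \<rho>"
  note [measurable] = weight_measurable[OF \<rho>]
  have "(LINT x|lborel. \<rho> x * \<bar>rep_ae_fun (c *\<^sub>R u) x\<bar>\<^sup>2)
      = (LINT x|lborel. c\<^sup>2 * (\<rho> x * \<bar>rep_ae_fun u x\<bar>\<^sup>2))"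
    by (rule integral_cong_AE)
      (use rep_scaleR_ae[of c u] in \<open>auto elim!: AE_mp simp: power_mult_distrib\<close>)
  then show ?thesis by (simp add: norm2_def real_sqrt_mult)
qed

lemma norm2_triangle:
  assumes \<rho>: "weight \<rho>" and "u \<in> L2 \<rho>" "v \<in> L2 \<rho>"
  shows "norm2 \<rho> (u + v) \<le> norm2 \<rho> u + norm2 \<rho> v"
  using Metric_space.triangle[OF Metric_space_L2[OF \<rho>], of u 0 "- v"] assms
    zero_in_L2[OF \<rho>] uminus_in_L2[OF \<rho>]
  by (simp add: dist2_def)

lemma norm2_zero: "weight \<rho> \<Longrightarrow> norm2 \<rho> 0 = 0"
  using norm2_scaleR[of \<rho> 0 0] by simp

lemma norm2_uminus: "weight \<rho> \<Longrightarrow> norm2 \<rho> (- u) = norm2 \<rho> u"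
  using norm2_scaleR[of \<rho> "-1" u] by simp

lemma norm2_triangle_diff:
  assumes \<rho>: "weight \<rho>" and "u \<in> L2 \<rho>" "v \<in> L2 \<rho>"
  shows "norm2 \<rho> (u - v) \<le> norm2 \<rho> u + norm2 \<rho> v"
  using norm2_triangle[OF \<rho>, of u "- v"] assms by (simp add: norm2_uminus uminus_in_L2)

text \<open>
  Membership in the space turns the square of the norm into a Lebesgue integral with values in
  the extended reals; there, bounds follow from pointwise ones with no integrability to check.
\<close>

lemma nn_integral_norm2:
  assumes \<rho>: "weight \<rho>" and "u \<in> L2 \<rho>"
  shows "(\<integral>\<^sup>+x. ennreal (\<rho> x * (rep_ae_fun u x)\<^sup>2) \<partial>lborel) = ennreal ((norm2 \<rho> u)\<^sup>2)"
proof -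
  have "0 \<le> (LINT x|lborel. \<rho> x * (rep_ae_fun u x)\<^sup>2)"
    using weight_pos[OF \<rho>] by (auto intro!: integral_nonneg_AE simp: less_imp_le)
  moreover have "(\<integral>\<^sup>+x. ennreal (\<rho> x * (rep_ae_fun u x)\<^sup>2) \<partial>lborel)
      = ennreal (LINT x|lborel. \<rho> x * (rep_ae_fun u x)\<^sup>2)"
    by (rule nn_integral_eq_integral)
      (use assms weight_pos[OF \<rho>] in \<open>auto simp: L2_def less_imp_le\<close>)
  ultimately show ?thesis by (simp add: norm2_def)
qed

lemma norm2_le_iff:
  assumes \<rho>: "weight \<rho>" and u: "u \<in> L2 \<rho>" and c: "0 \<le> c"
  shows "norm2 \<rho> u \<le> c \<longleftrightarrow> (\<integral>\<^sup>+x. ennreal (\<rho> x * (rep_ae_fun u x)\<^sup>2) \<partial>lborel) \<le> ennreal (c\<^sup>2)"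
  using norm2_nonneg[OF \<rho>, of u] c by (simp add: nn_integral_norm2[OF \<rho> u] power_mono_iff)

lemma continuous_on_norm2_diff:
  assumes \<rho>: "weight \<rho>"
    and u: "continuous_map (top_of_set T) (top2 \<rho>) u"
    and v: "continuous_map (top_of_set T) (top2 \<rho>) v"
  shows "continuous_on T (\<lambda>t. norm2 \<rho> (u t - v t))"
proof -
  note M = Metric_space_L2[OF \<rho>]
  let ?m = "metric (L2 \<rho>, dist2 \<rho>)"
  have "mtopology_of ?m = top2 \<rho>" "mdist ?m = dist2 \<rho>"
    using M by (auto simp: mtopology_of_def Metric_space.mspace_metric Metric_space.mdist_metric)
  then show ?thesis
    using continuous_map_mdist[of "top_of_set T" ?m u v] u v by (simp add: dist2_def)
qed

lemma curve_in_L2: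
  assumes "weight \<rho>" "continuous_map (top_of_set T) (top2 \<rho>) u" "t \<in> T"
  shows "u t \<in> L2 \<rho>"
  using assms Metric_space.topspace_mtopology[OF Metric_space_L2[of \<rho>]]
  by (auto simp: continuous_map_def)


section \<open>The convolution\<close>

lemma conv_kernel_continuous: "conv_kernel J \<Longrightarrow> continuous_on UNIV J"
  unfolding conv_kernel_def
  by (metis UNIV_I differentiable_def differentiable_imp_continuous_within continuous_at_imp_continuous_on)

lemma conv_kernel_measurable: "conv_kernel J \<Longrightarrow> J \<in> borel_measurable borel"
  by (intro borel_measurable_continuous_onI conv_kernel_continuous)

lemma conv_kernel_support:
  assumes "conv_kernel J" "J x \<noteq> 0"
  shows "norm x \<le> 1"
  using assms closure_subset[of "{x. J x \<noteq> 0}"] unfolding conv_kernel_def by auto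

lemma conv_kernel_bounded:
  assumes J: "conv_kernel J"
  obtains M where "\<And>x. \<bar>J x\<bar> \<le> M"
proof -
  have "compact (J ` cball 0 1)"
    using conv_kernel_continuous[OF J]
    by (intro compact_continuous_image compact_cball) (auto intro: continuous_on_subset)
  then obtain M where M: "\<And>x. norm x \<le> 1 \<Longrightarrow> \<bar>J x\<bar> \<le> M"
    by (auto dest!: compact_imp_bounded simp: bounded_iff) (metis mem_cball_0)
  have "\<bar>J x\<bar> \<le> M" for x
    using M[of x] M[of 0] conv_kernel_support[OF J, of x] by (cases "J x = 0") auto
  then show thesis by (rule that)
qed

lemma nn_integral_conv_kernel:
  assumes J: "conv_kernel J"
  shows "(\<integral>\<^sup>+x. ennreal (J (x - y)) \<partial>lborel) = 1" "(\<integral>\<^sup>+x. ennreal (J (y - x)) \<partial>lborel) = 1"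
proof -
  note [measurable] = conv_kernel_measurable[OF J]
  have "1 = (\<integral>\<^sup>+x. ennreal (J x) \<partial>lborel)"
    using J by (subst nn_integral_eq_integral) (auto simp: conv_kernel_def)
  also have "\<dots> = (\<integral>\<^sup>+x. ennreal (J x) \<partial>distr lborel borel ((+) (- y)))"
    by (simp only: lborel_distr_plus)
  also have "\<dots> = (\<integral>\<^sup>+x. ennreal (J (x - y)) \<partial>lborel)"
    by (subst nn_integral_distr) auto
  finally show 1: "(\<integral>\<^sup>+x. ennreal (J (x - y)) \<partial>lborel) = 1" ..
  have "J (y - x) = J (x - y)" for x
    using J unfolding conv_kernel_def by (metis minus_diff_eq)
  then show "(\<integral>\<^sup>+x. ennreal (J (y - x)) \<partial>lborel) = 1"
    using 1 by simp
qed

lemma conv_integrable: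
  assumes J: "conv_kernel J" and u: "u \<in> L1_loc"
  shows "integrable lborel (\<lambda>y. J (x - y) * rep_ae_fun u y)"
proof -
  note [measurable] = conv_kernel_measurable[OF J]
  obtain M where M: "\<And>x. \<bar>J x\<bar> \<le> M" using conv_kernel_bounded[OF J] by blast
  have "set_integrable lborel (cball x 1) (rep_ae_fun u)"
    using u by (auto simp: L1_loc_def)
  then have "integrable lborel (\<lambda>y. M * (indicator (cball x 1) y *\<^sub>R rep_ae_fun u y))"
    by (auto simp: set_integrable_def)
  then show ?thesis
  proof (rule Bochner_Integration.integrable_bound)
    have "\<bar>J (x - y) * rep_ae_fun u y\<bar> \<le> \<bar>M * (indicator (cball x 1) y *\<^sub>R rep_ae_fun u y)\<bar>" for y
    proof (cases "J (x - y) = 0")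
      case False
      then have "y \<in> cball x 1"
        using conv_kernel_support[OF J, of "x - y"] by (simp add: dist_norm)
      then show ?thesis
        using M[of "x - y"] by (auto simp: abs_mult intro!: mult_right_mono)
    qed simp
    then show "AE y in lborel. norm (J (x - y) * rep_ae_fun u y)
        \<le> norm (M * (indicator (cball x 1) y *\<^sub>R rep_ae_fun u y))"
      by simp
  qed measurable
qed

lemma conv_measurable:
  assumes J: "conv_kernel J"
  shows "conv J u \<in> borel_measurable borel"
proof -
  note [measurable] = conv_kernel_measurable[OF J]
  show ?thesis unfolding conv_def[abs_def] by measurable
qed

lemma conv_diff:
  assumes J: "conv_kernel J" and "u \<in> L1_loc" "v \<in> L1_loc"
  shows "conv J (u - v) x = conv J u x - conv J v x"
proof -
  note [measurable] = conv_kernel_measurable[OF J]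
  have "conv J (u - v) x = (LINT y|lborel. J (x - y) * rep_ae_fun u y - J (x - y) * rep_ae_fun v y)"
    unfolding conv_def
    by (rule integral_cong_AE)
      (use rep_minus_ae[of u v] in \<open>auto elim!: AE_mp simp: right_diff_distrib\<close>)
  also have "\<dots> = conv J u x - conv J v x"
    unfolding conv_def using assms by (intro Bochner_Integration.integral_diff conv_integrable)
  finally show ?thesis .
qed

text \<open>
  Jensen's inequality for the square, obtained from Cauchy-Schwarz by splitting \<open>p f\<close> into
  \<open>sqrt p\<close> and \<open>sqrt p f\<close>. Stating it with an extended integral on the right, and relying on the
  value 0 of the integral of a non-integrable function on the left, it holds for all measurable \<open>f\<close>.
\<close>

lemma weighted_mean_square_le:
  fixes p f :: "'a \<Rightarrow> real"
  assumes [measurable]: "p \<in> borel_measurable M" "f \<in> borel_measurable M"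
    and p: "\<And>y. 0 \<le> p y" "(\<integral>\<^sup>+y. ennreal (p y) \<partial>M) = 1"
  shows "ennreal ((LINT y|M. p y * f y)\<^sup>2) \<le> (\<integral>\<^sup>+y. ennreal (p y * (f y)\<^sup>2) \<partial>M)"
proof (cases "integrable M (\<lambda>y. p y * f y)")
  case True
  have "ennreal \<bar>LINT y|M. p y * f y\<bar> \<le> (\<integral>\<^sup>+y. ennreal \<bar>p y * f y\<bar> \<partial>M)"
    using integral_norm_bound_ennreal[OF True] by simp
  also have "\<dots> = (\<integral>\<^sup>+y. ennreal (sqrt (p y)) * ennreal (sqrt (p y) * \<bar>f y\<bar>) \<partial>M)"
    using p(1) by (simp add: ennreal_mult[symmetric] abs_mult mult.assoc[symmetric])
  finally have "(ennreal \<bar>LINT y|M. p y * f y\<bar>)\<^sup>2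
      \<le> (\<integral>\<^sup>+y. ennreal (sqrt (p y)) * ennreal (sqrt (p y) * \<bar>f y\<bar>) \<partial>M)\<^sup>2"
    by (intro power_mono) auto
  also have "\<dots> \<le> (\<integral>\<^sup>+y. (ennreal (sqrt (p y)))\<^sup>2 \<partial>M) * (\<integral>\<^sup>+y. (ennreal (sqrt (p y) * \<bar>f y\<bar>))\<^sup>2 \<partial>M)"
    by (rule Cauchy_Schwarz_nn_integral) auto
  also have "\<dots> = (\<integral>\<^sup>+y. ennreal (p y * (f y)\<^sup>2) \<partial>M)"
    using p by (simp add: ennreal_power power_mult_distrib)
  finally show ?thesis by (simp add: ennreal_power)
qed (simp add: not_integrable_integral_eq)

text \<open>
  By Jensen's inequality the square of the average \<open>conv J w x\<close> is at most the average of the squares.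
  After exchanging the integrals, the weight is averaged instead; as \<open>J (x - y)\<close> vanishes unless \<open>x\<close>
  lies in the unit ball around \<open>y\<close>, it may be replaced by \<open>K * \<rho> y\<close>.
\<close>

lemma conv_weighted_bound:
  fixes \<rho> J :: "'a::euclidean_space \<Rightarrow> real"
  assumes \<rho>: "weight \<rho>" and J: "conv_kernel J" and K: "0 \<le> K"
    and doubling: "\<And>x y. norm (x - y) \<le> 1 \<Longrightarrow> \<rho> x \<le> K * \<rho> y"
  shows "(\<integral>\<^sup>+x. ennreal (\<rho> x * (conv J w x)\<^sup>2) \<partial>lborel)
    \<le> ennreal K * (\<integral>\<^sup>+y. ennreal (\<rho> y * (rep_ae_fun w y)\<^sup>2) \<partial>lborel)"
proof -
  note [measurable] = conv_kernel_measurable[OF J] weight_measurable[OF \<rho>] conv_measurable[OF J]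
  have nn: "0 \<le> \<rho> x" "0 \<le> J x" for x
    using weight_pos[OF \<rho>, of x] J by (auto simp: conv_kernel_def)
  let ?w = "rep_ae_fun w"
  have "(\<integral>\<^sup>+x. ennreal (\<rho> x * (conv J w x)\<^sup>2) \<partial>lborel)
      \<le> (\<integral>\<^sup>+x. ennreal (\<rho> x) * (\<integral>\<^sup>+y. ennreal (J (x - y) * (?w y)\<^sup>2) \<partial>lborel) \<partial>lborel)"
    unfolding conv_def
  proof (intro nn_integral_mono)
    fix x
    have "ennreal ((LINT y|lborel. J (x - y) * ?w y)\<^sup>2) \<le> (\<integral>\<^sup>+y. ennreal (J (x - y) * (?w y)\<^sup>2) \<partial>lborel)"
      using nn by (intro weighted_mean_square_le nn_integral_conv_kernel[OF J]) auto
    then show "ennreal (\<rho> x * (LINT y|lborel. J (x - y) * ?w y)\<^sup>2)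
        \<le> ennreal (\<rho> x) * (\<integral>\<^sup>+y. ennreal (J (x - y) * (?w y)\<^sup>2) \<partial>lborel)"
      using nn[of x] by (simp add: ennreal_mult mult_left_mono)
  qed
  also have "\<dots> = (\<integral>\<^sup>+x. \<integral>\<^sup>+y. ennreal (\<rho> x) * ennreal (J (x - y) * (?w y)\<^sup>2) \<partial>lborel \<partial>lborel)"
    by (simp add: nn_integral_cmult)
  also have "\<dots> = (\<integral>\<^sup>+y. \<integral>\<^sup>+x. ennreal (\<rho> x) * ennreal (J (x - y) * (?w y)\<^sup>2) \<partial>lborel \<partial>lborel)"
    by (rule lborel_pair.Fubini') measurable
  also have "\<dots> \<le> (\<integral>\<^sup>+y. \<integral>\<^sup>+x. ennreal (K * (\<rho> y * (?w y)\<^sup>2)) * ennreal (J (x - y)) \<partial>lborel \<partial>lborel)"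
  proof (intro nn_integral_mono)
    fix x y
    have "\<rho> x * (J (x - y) * (?w y)\<^sup>2) \<le> K * (\<rho> y * (?w y)\<^sup>2) * J (x - y)"
    proof (cases "J (x - y) = 0")
      case False
      then have "\<rho> x \<le> K * \<rho> y"
        using conv_kernel_support[OF J] doubling by blast
      from mult_right_mono[OF this, of "J (x - y) * (?w y)\<^sup>2"] nn show ?thesis
        by (simp add: mult_ac)
    qed simp
    then show "ennreal (\<rho> x) * ennreal (J (x - y) * (?w y)\<^sup>2)
        \<le> ennreal (K * (\<rho> y * (?w y)\<^sup>2)) * ennreal (J (x - y))"
      using nn K by (simp add: ennreal_mult[symmetric] ennreal_leI)
  qed
  also have "\<dots> = ennreal K * (\<integral>\<^sup>+y. ennreal (\<rho> y * (?w y)\<^sup>2) \<partial>lborel)"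
    using nn K by (simp add: nn_integral_cmult nn_integral_conv_kernel[OF J] ennreal_mult)
  finally show ?thesis .
qed

section \<open>The reaction term\<close>

definition reaction ::
  "('a::euclidean_space \<Rightarrow> real) \<Rightarrow> real \<Rightarrow> (real \<Rightarrow> real) \<Rightarrow> (real \<Rightarrow> real \<Rightarrow> real) \<Rightarrow>
   real \<Rightarrow> 'a ae_fun \<Rightarrow> 'a ae_fun" where
  "reaction J \<beta> g h t u = abs_ae_fun (\<lambda>x. g (\<beta> * conv J u x + \<beta> * h t (rep_ae_fun u x)))"

lemma rhs_eq_reaction: "rhs J \<beta> g h t u = - u + reaction J \<beta> g h t u"
  by (simp add: rhs_def reaction_def)

text \<open>
  The reaction term is the class of a function that involves a chosen representative of \<open>u\<close>; this
  describes it only because that function is Borel measurable.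
\<close>

lemma rep_reaction_ae:
  assumes J: "conv_kernel J" and [measurable]: "g \<in> borel_measurable borel" "h t \<in> borel_measurable borel"
  shows "AE x in lborel. rep_ae_fun (reaction J \<beta> g h t u) x
    = g (\<beta> * conv J u x + \<beta> * h t (rep_ae_fun u x))"
proof -
  note [measurable] = conv_measurable[OF J]
  show ?thesis unfolding reaction_def by (rule rep_abs_ae_fun) measurable
qed

text \<open>
  The weight has total mass 1, so constants have norm equal to their absolute value.
\<close>

lemma norm2_le_of_ae_bound:
  assumes \<rho>: "weight \<rho>" and u: "u \<in> L2 \<rho>" and ae: "AE x in lborel. \<bar>rep_ae_fun u x\<bar> \<le> c" and c: "0 \<le> c"
  shows "norm2 \<rho> u \<le> c"
proof -
  note [measurable] = weight_measurable[OF \<rho>]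
  have "(\<integral>\<^sup>+x. ennreal (\<rho> x * (rep_ae_fun u x)\<^sup>2) \<partial>lborel)
      \<le> (\<integral>\<^sup>+x. ennreal (c\<^sup>2) * ennreal (\<rho> x) \<partial>lborel)"
  proof (rule nn_integral_mono_AE)
    show "AE x in lborel. ennreal (\<rho> x * (rep_ae_fun u x)\<^sup>2) \<le> ennreal (c\<^sup>2) * ennreal (\<rho> x)"
      using ae
    proof eventually_elim
      case (elim x)
      then have "(rep_ae_fun u x)\<^sup>2 \<le> c\<^sup>2"
        by (simp add: abs_le_square_iff[symmetric])
      then show ?case
        using weight_pos[OF \<rho>, of x]
        by (simp add: ennreal_mult[symmetric] ennreal_leI mult.commute mult_right_mono)
    qed
  qed
  also have "\<dots> = ennreal (c\<^sup>2)"
    by (simp add: nn_integral_cmult nn_integral_weight[OF \<rho>])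
  finally show ?thesis using norm2_le_iff[OF \<rho> u c] by simp
qed

lemma norm2_reaction_le:
  assumes "weight \<rho>" "conv_kernel J" "g \<in> borel_measurable borel" "h t \<in> borel_measurable borel"
    and "\<And>s. \<bar>g s\<bar> \<le> a" and "reaction J \<beta> g h t u \<in> L2 \<rho>"
  shows "norm2 \<rho> (reaction J \<beta> g h t u) \<le> a"
proof (rule norm2_le_of_ae_bound)
  show "AE x in lborel. \<bar>rep_ae_fun (reaction J \<beta> g h t u) x\<bar> \<le> a"
    using rep_reaction_ae[where h = h and t = t and u = u and \<beta> = \<beta>, OF assms(2-4)] by eventually_elim (use assms(5) in auto)
  show "0 \<le> a" using assms(5)[of 0] by linarith
qed (use assms in auto)

lemma square_sum3_le: "(a + b + c)\<^sup>2 \<le> 3 * (a\<^sup>2 + b\<^sup>2 + c\<^sup>2)" for a b c :: real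
proof -
  have "0 \<le> (a - b)\<^sup>2 + (b - c)\<^sup>2 + (a - c)\<^sup>2" by simp
  then show ?thesis by (simp add: power2_eq_square algebra_simps)
qed

text \<open>
  Lipschitz dependence on the state and on the nonlinearity at once: the difference splits as
  \<open>h t u - h' t v = (h t u - h' t u) + (h' t u - h' t v)\<close>, so that the constant
  involves the Lipschitz bound of \<open>h'\<close> alone and is uniform in \<open>h\<close>. The factor \<open>sqrt 3\<close> comes from bounding the square of a
  sum of three terms by three times the sum of their squares.
\<close>

lemma norm2_reaction_diff_le:
  fixes \<rho> J :: "'a::euclidean_space \<Rightarrow> real"
  assumes \<rho>: "weight \<rho>" and J: "conv_kernel J" and K: "0 \<le> K"
    and doubling: "\<And>x y. norm (x - y) \<le> 1 \<Longrightarrow> \<rho> x \<le> K * \<rho> y"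
    and \<beta>: "0 \<le> \<beta>"
    and g: "lg-lipschitz_on UNIV g"
    and meas: "h t \<in> borel_measurable borel" and lip: "lh-lipschitz_on UNIV (h' t)"
    and close: "\<And>s. \<bar>h t s - h' t s\<bar> \<le> \<eta>"
    and u: "u \<in> L2 \<rho>" "v \<in> L2 \<rho>"
    and F: "reaction J \<beta> g h t u \<in> L2 \<rho>" "reaction J \<beta> g h' t v \<in> L2 \<rho>"
  shows "norm2 \<rho> (reaction J \<beta> g h t u - reaction J \<beta> g h' t v)
    \<le> lg * \<beta> * sqrt 3 * (sqrt (K + lh\<^sup>2) * norm2 \<rho> (u - v) + \<eta>)"
proof -
  note [measurable] = conv_kernel_measurable[OF J] weight_measurable[OF \<rho>] conv_measurable[OF J]
  have nn: "0 \<le> \<rho> x" for x using weight_pos[OF \<rho>, of x] by simp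
  have \<eta>: "0 \<le> \<eta>" using close[of 0] by linarith
  have lg: "0 \<le> lg" and lh: "0 \<le> lh" using g lip by (auto dest: lipschitz_on_nonneg)
  have gm: "g \<in> borel_measurable borel" and hm: "h' t \<in> borel_measurable borel"
    using g lip by (auto intro!: borel_measurable_continuous_onI dest: lipschitz_on_continuous_on)
  let ?w = "u - v"
  let ?D = "reaction J \<beta> g h t u - reaction J \<beta> g h' t v"
  define c where "c = lg * \<beta> * sqrt 3"
  have c: "0 \<le> c" using lg \<beta> by (simp add: c_def)
  have L1: "u \<in> L1_loc" "v \<in> L1_loc" using u by (auto simp: L2_def)
  have w: "?w \<in> L2 \<rho>" and D: "?D \<in> L2 \<rho>" using u F diff_in_L2[OF \<rho>] by auto
  define b where "b = c * (sqrt (K + lh\<^sup>2) * norm2 \<rho> ?w + \<eta>)"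
  have pointwise: "AE x in lborel. \<rho> x * (rep_ae_fun ?D x)\<^sup>2
      \<le> c\<^sup>2 * (\<rho> x * (conv J ?w x)\<^sup>2 + lh\<^sup>2 * (\<rho> x * (rep_ae_fun ?w x)\<^sup>2) + \<eta>\<^sup>2 * \<rho> x)"
    using rep_minus_ae[of "reaction J \<beta> g h t u" "reaction J \<beta> g h' t v"] rep_minus_ae[of u v]
      rep_reaction_ae[where h = h and t = t and u = u and \<beta> = \<beta>, OF J gm meas]
      rep_reaction_ae[where h = h' and t = t and u = v and \<beta> = \<beta>, OF J gm hm]
  proof eventually_elim
    case (elim x)
    define p q where "p = h t (rep_ae_fun u x)" and "q = h' t (rep_ae_fun v x)"
    have "\<bar>h' t (rep_ae_fun u x) - q\<bar> \<le> lh * \<bar>rep_ae_fun u x - rep_ae_fun v x\<bar>"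
      using lipschitz_onD[OF lip, of "rep_ae_fun u x" "rep_ae_fun v x"]
      by (simp only: q_def dist_real_def UNIV_I)
    then have "\<bar>p - q\<bar> \<le> \<eta> + lh * \<bar>rep_ae_fun ?w x\<bar>"
      using close[of "rep_ae_fun u x"] unfolding elim(2) p_def by linarith
    then have "\<bar>conv J ?w x + (p - q)\<bar> \<le> \<bar>conv J ?w x\<bar> + lh * \<bar>rep_ae_fun ?w x\<bar> + \<eta>"
      by linarith
    then have sum_le: "\<bar>\<beta> * (conv J ?w x + (p - q))\<bar>
        \<le> \<beta> * (\<bar>conv J ?w x\<bar> + lh * \<bar>rep_ae_fun ?w x\<bar> + \<eta>)"
      using \<beta> by (simp only: abs_mult abs_of_nonneg mult_left_mono)
    have "\<bar>rep_ae_fun ?D x\<bar> \<le> lg * \<bar>(\<beta> * conv J u x + \<beta> * p) - (\<beta> * conv J v x + \<beta> * q)\<bar>"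
      using lipschitz_onD[OF g, of "\<beta> * conv J u x + \<beta> * p" "\<beta> * conv J v x + \<beta> * q"]
      unfolding elim(1,3,4) p_def q_def by (simp only: dist_real_def UNIV_I)
    also have "(\<beta> * conv J u x + \<beta> * p) - (\<beta> * conv J v x + \<beta> * q) = \<beta> * (conv J ?w x + (p - q))"
      by (simp add: conv_diff[OF J L1] algebra_simps)
    also have "lg * \<bar>\<dots>\<bar> \<le> lg * (\<beta> * (\<bar>conv J ?w x\<bar> + lh * \<bar>rep_ae_fun ?w x\<bar> + \<eta>))"
      using sum_le lg by (rule mult_left_mono)
    finally have D_le: "\<bar>rep_ae_fun ?D x\<bar>
        \<le> lg * (\<beta> * (\<bar>conv J ?w x\<bar> + lh * \<bar>rep_ae_fun ?w x\<bar> + \<eta>))" .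
    have "(rep_ae_fun ?D x)\<^sup>2 \<le> (lg * (\<beta> * (\<bar>conv J ?w x\<bar> + lh * \<bar>rep_ae_fun ?w x\<bar> + \<eta>)))\<^sup>2"
      using power_mono[OF D_le, of 2] by simp
    also have "\<dots> = (lg * \<beta>)\<^sup>2 * (\<bar>conv J ?w x\<bar> + lh * \<bar>rep_ae_fun ?w x\<bar> + \<eta>)\<^sup>2"
      by (simp add: power_mult_distrib)
    also have "\<dots> \<le> (lg * \<beta>)\<^sup>2 * (3 * ((conv J ?w x)\<^sup>2 + lh\<^sup>2 * (rep_ae_fun ?w x)\<^sup>2 + \<eta>\<^sup>2))"
      using square_sum3_le[of "\<bar>conv J ?w x\<bar>" "lh * \<bar>rep_ae_fun ?w x\<bar>" \<eta>]
      by (intro mult_left_mono) (auto simp: power_mult_distrib)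
    also have "\<dots> = c\<^sup>2 * ((conv J ?w x)\<^sup>2 + lh\<^sup>2 * (rep_ae_fun ?w x)\<^sup>2 + \<eta>\<^sup>2)"
      by (simp add: c_def power_mult_distrib)
    finally have "\<rho> x * (rep_ae_fun ?D x)\<^sup>2
        \<le> \<rho> x * (c\<^sup>2 * ((conv J ?w x)\<^sup>2 + lh\<^sup>2 * (rep_ae_fun ?w x)\<^sup>2 + \<eta>\<^sup>2))"
      using nn[of x] by (rule mult_left_mono)
    then show ?case by (simp add: algebra_simps)
  qed
  have "(\<integral>\<^sup>+x. ennreal (\<rho> x * (rep_ae_fun ?D x)\<^sup>2) \<partial>lborel)
      \<le> (\<integral>\<^sup>+x. ennreal (c\<^sup>2) * (ennreal (\<rho> x * (conv J ?w x)\<^sup>2)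
        + ennreal (lh\<^sup>2) * ennreal (\<rho> x * (rep_ae_fun ?w x)\<^sup>2) + ennreal (\<eta>\<^sup>2) * ennreal (\<rho> x)) \<partial>lborel)"
    by (rule nn_integral_mono_AE)
      (use pointwise nn in \<open>auto elim!: AE_mp intro!: ennreal_leI simp: ennreal_mult[symmetric] ennreal_plus[symmetric] simp del: ennreal_plus\<close>)
  also have "\<dots> = ennreal (c\<^sup>2) * ((\<integral>\<^sup>+x. ennreal (\<rho> x * (conv J ?w x)\<^sup>2) \<partial>lborel)
      + ennreal (lh\<^sup>2) * ennreal ((norm2 \<rho> ?w)\<^sup>2) + ennreal (\<eta>\<^sup>2))"
    by (simp add: nn_integral_cmult nn_integral_add nn_integral_weight[OF \<rho>] nn_integral_norm2[OF \<rho> w])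
  also have "\<dots> \<le> ennreal (c\<^sup>2) * (ennreal K * ennreal ((norm2 \<rho> ?w)\<^sup>2)
      + ennreal (lh\<^sup>2) * ennreal ((norm2 \<rho> ?w)\<^sup>2) + ennreal (\<eta>\<^sup>2))"
    using conv_weighted_bound[OF \<rho> J K doubling, of ?w]
    by (intro mult_left_mono add_mono) (auto simp: nn_integral_norm2[OF \<rho> w])
  also have "\<dots> = ennreal (c\<^sup>2 * ((K + lh\<^sup>2) * (norm2 \<rho> ?w)\<^sup>2 + \<eta>\<^sup>2))"
    using K by (simp add: ennreal_mult[symmetric] ennreal_plus[symmetric] distrib_right del: ennreal_plus)
  also have "\<dots> \<le> ennreal (b\<^sup>2)"
  proof (intro ennreal_leI)
    have "(K + lh\<^sup>2) * (norm2 \<rho> ?w)\<^sup>2 = (sqrt (K + lh\<^sup>2) * norm2 \<rho> ?w)\<^sup>2"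
      using K by (simp add: power_mult_distrib)
    then have "(K + lh\<^sup>2) * (norm2 \<rho> ?w)\<^sup>2 + \<eta>\<^sup>2 \<le> (sqrt (K + lh\<^sup>2) * norm2 \<rho> ?w + \<eta>)\<^sup>2"
      using \<eta> K norm2_nonneg[OF \<rho>, of ?w] by (simp add: power2_sum)
    then show "c\<^sup>2 * ((K + lh\<^sup>2) * (norm2 \<rho> ?w)\<^sup>2 + \<eta>\<^sup>2) \<le> b\<^sup>2"
      by (simp add: b_def power_mult_distrib mult_left_mono)
  qed
  finally have "norm2 \<rho> ?D \<le> b"
    using norm2_le_iff[OF \<rho> D, of b] c \<eta> K norm2_nonneg[OF \<rho>, of ?w] by (simp add: b_def)
  then show ?thesis by (simp add: b_def c_def)
qed


section \<open>A Gronwall inequality for left difference quotients\<close>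

text \<open>
  At the first time \<open>s\<close> at which \<open>\<phi>\<close> reaches \<open>\<psi>\<close>, the two functions agree and \<open>\<phi>\<close> lies below \<open>\<psi>\<close> to
  the left. Hence \<open>\<psi>\<close> grows there no faster than the bound for \<open>\<phi>\<close>, namely \<open>c * \<psi> s + \<eta>\<close>,
  whereas a strict supersolution grows faster.
\<close>

lemma comparison_left_growth:
  fixes \<phi> \<psi> :: "real \<Rightarrow> real"
  assumes cont: "continuous_on {\<tau>..} \<phi>"
    and growth: "\<And>t e. \<tau> < t \<Longrightarrow> 0 < e \<Longrightarrow>
      \<forall>\<^sub>F r in at_left t. \<phi> t \<le> \<phi> r + (t - r) * (c * \<phi> t + \<eta> + e)"
    and deriv: "\<And>t. (\<psi> has_real_derivative \<psi>' t) (at t)"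
    and super: "\<And>t. c * \<psi> t + \<eta> < \<psi>' t"
    and init: "\<phi> \<tau> < \<psi> \<tau>" and t: "\<tau> \<le> t"
  shows "\<phi> t < \<psi> t"
proof (rule ccontr)
  assume "\<not> \<phi> t < \<psi> t"
  define V where "V = {r \<in> {\<tau>..t}. 0 \<le> \<phi> r - \<psi> r}"
  have cont_\<psi>: "continuous_on X \<psi>" for X
    using deriv by (auto intro: DERIV_continuous_on DERIV_subset)
  have cont': "continuous_on {\<tau>..t} (\<lambda>r. \<phi> r - \<psi> r)"
    using cont by (intro continuous_on_diff cont_\<psi>) (auto intro: continuous_on_subset)
  have "closed V"
    unfolding V_def by (intro continuous_on_closed_Collect_le cont' continuous_on_const closed_atLeastAtMost)
  moreover have "t \<in> V" "bounded V"
    using t \<open>\<not> \<phi> t < \<psi> t\<close> by (auto simp: V_def intro: bounded_subset[of "{\<tau>..t}"])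
  ultimately obtain s where s: "s \<in> V" and first: "\<And>r. r \<in> V \<Longrightarrow> s \<le> r"
    using compact_attains_inf[of V] by (auto simp: compact_eq_bounded_closed)
  have "\<tau> < s" using s init by (cases "s = \<tau>") (auto simp: V_def)
  have below: "\<phi> r < \<psi> r" if "\<tau> \<le> r" "r < s" for r
    using first[of r] that s by (force simp: V_def)
  have lim: "((\<lambda>r. \<phi> r - \<psi> r) \<longlongrightarrow> \<phi> s - \<psi> s) (at_left s)"
  proof -
    have "((\<lambda>r. \<phi> r - \<psi> r) \<longlongrightarrow> \<phi> s - \<psi> s) (at s within {\<tau>..t})"
      using cont' s by (auto simp: continuous_on_def V_def)
    then have "((\<lambda>r. \<phi> r - \<psi> r) \<longlongrightarrow> \<phi> s - \<psi> s) (at s within {\<tau>..s})"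
      by (rule tendsto_within_subset) (use s in \<open>auto simp: V_def\<close>)
    then show ?thesis using \<open>\<tau> < s\<close> by (simp add: at_within_Icc_at_left)
  qed
  have near: "\<forall>\<^sub>F r in at_left s. \<tau> < r \<and> r < s"
    using \<open>\<tau> < s\<close> by (auto simp: eventually_at_left[of \<tau>])
  have "\<phi> s - \<psi> s \<le> 0"
    using near by (intro tendsto_upperbound[OF lim]) (auto elim!: eventually_mono intro!: less_imp_le below)
  then have eq: "\<phi> s = \<psi> s" using s by (simp add: V_def)
  \<comment> \<open>half the gap between the slope of \<open>\<psi>\<close> and the growth bound at the touching time\<close>
  define e where "e = (\<psi>' s - (c * \<psi> s + \<eta>)) / 2"
  have "0 < e" using super[of s] by (simp add: e_def)
  have slope: "((\<lambda>r. (\<psi> r - \<psi> s) / (r - s)) \<longlongrightarrow> \<psi>' s) (at_left s)"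
    using deriv[of s] by (auto simp: has_field_derivative_iff intro: tendsto_within_subset)
  have "\<forall>\<^sub>F r in at_left s. \<psi>' s - e < (\<psi> r - \<psi> s) / (r - s)"
    by (rule order_tendstoD(1)[OF slope]) (use \<open>0 < e\<close> in simp)
  moreover have "\<forall>\<^sub>F r in at_left s. \<phi> s \<le> \<phi> r + (s - r) * (c * \<phi> s + \<eta> + e)"
    using growth \<open>\<tau> < s\<close> \<open>0 < e\<close> by blast
  ultimately have "\<forall>\<^sub>F r in at_left s. False"
    using near
  proof eventually_elim
    case (elim r)
    then have "\<psi> r - \<psi> s < (\<psi>' s - e) * (r - s)"
      by (simp add: neg_less_divide_eq)
    also have "\<psi>' s - e = c * \<phi> s + \<eta> + e"
      by (simp add: e_def eq field_simps)
    finally have "\<psi> r < \<psi> s - (s - r) * (c * \<phi> s + \<eta> + e)"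
      by (simp add: algebra_simps)
    then show False using elim below[of r] eq by simp
  qed
  then show False by simp
qed

text \<open>
  The right-hand side solves \<open>y' = c y + \<eta>\<close> with initial value \<open>\<phi> \<tau>\<close>. Raising both \<open>\<eta>\<close> and the
  initial value by \<open>e\<close> turns it into a strict supersolution; then \<open>e\<close> tends to 0.
\<close>

lemma exponential_bound_of_left_growth:
  fixes \<phi> :: "real \<Rightarrow> real"
  assumes cont: "continuous_on {\<tau>..} \<phi>"
    and growth: "\<And>t e. \<tau> < t \<Longrightarrow> 0 < e \<Longrightarrow>
      \<forall>\<^sub>F r in at_left t. \<phi> t \<le> \<phi> r + (t - r) * (c * \<phi> t + \<eta> + e)"
    and c: "c \<noteq> 0" and t: "\<tau> \<le> t"
  shows "\<phi> t \<le> \<phi> \<tau> * exp (c * (t - \<tau>)) + \<eta> / c * (exp (c * (t - \<tau>)) - 1)"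
proof -
  define \<psi> where "\<psi> e r = (\<phi> \<tau> + e) * exp (c * (r - \<tau>)) + (\<eta> + e) / c * (exp (c * (r - \<tau>)) - 1)"
    for e r
  have "\<phi> t < \<psi> e t" if "0 < e" for e
  proof (rule comparison_left_growth[OF cont growth _ _ _ t])
    fix r
    show "(\<psi> e has_real_derivative (c * \<psi> e r + \<eta> + e)) (at r)"
      unfolding \<psi>_def[abs_def]
      by (rule derivative_eq_intros refl | simp)+ (use c in \<open>simp add: field_simps\<close>)
  qed (use that in \<open>auto simp: \<psi>_def\<close>)
  then have "\<forall>\<^sub>F e in at_right 0. \<phi> t \<le> \<psi> e t"
    by (auto simp: eventually_at_filter less_imp_le)
  moreover have "((\<lambda>e. \<psi> e t) \<longlongrightarrow> \<psi> 0 t) (at_right 0)"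
    unfolding \<psi>_def using c by (intro tendsto_intros)
  ultimately have "\<phi> t \<le> \<psi> 0 t"
    by (intro tendsto_lowerbound[of "\<lambda>e. \<psi> e t"]) auto
  then show ?thesis by (simp add: \<psi>_def)
qed

section \<open>Estimates for solutions\<close>

text \<open>
  If \<open>w' = G - w\<close> at \<open>t\<close>, then for \<open>r < t\<close> the expansion of \<open>w r\<close> around \<open>t\<close> reads
  \<open>(1 + (t - r)) w t = w r + (t - r) (G + z r)\<close> with an error \<open>z r\<close> that tends to 0. The damping term
  \<open>- w\<close> thus ends up as the factor \<open>1 + (t - r)\<close> of \<open>w t\<close>, and the triangle inequality gives the claim.
\<close>

lemma norm2_left_growth:
  assumes \<rho>: "weight \<rho>" and "\<tau> < t"
    and w: "\<And>r. \<tau> \<le> r \<Longrightarrow> w r \<in> L2 \<rho>" and G: "G \<in> L2 \<rho>"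
    and deriv: "((\<lambda>r. norm2 \<rho> ((w r - w t) /\<^sub>R (r - t) - (G - w t))) \<longlongrightarrow> 0) (at t)"
    and e: "0 < e"
  shows "\<forall>\<^sub>F r in at_left t. norm2 \<rho> (w t) \<le> norm2 \<rho> (w r) + (t - r) * (norm2 \<rho> G - norm2 \<rho> (w t) + e)"
proof -
  define z where "z r = (w r - w t) /\<^sub>R (r - t) - (G - w t)" for r
  have "((\<lambda>r. norm2 \<rho> (z r)) \<longlongrightarrow> 0) (at_left t)"
    unfolding z_def using deriv by (rule tendsto_within_subset) simp
  then have "\<forall>\<^sub>F r in at_left t. norm2 \<rho> (z r) < e"
    using e by (rule order_tendstoD)
  moreover have "\<forall>\<^sub>F r in at_left t. \<tau> < r \<and> r < t"
    using \<open>\<tau> < t\<close> by (auto simp: eventually_at_left[of \<tau>])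
  ultimately show ?thesis
  proof eventually_elim
    case (elim r)
    have wt: "w t \<in> L2 \<rho>" and wr: "w r \<in> L2 \<rho>" using w elim \<open>\<tau> < t\<close> by auto
    have z: "z r \<in> L2 \<rho>"
      unfolding z_def using wt wr G by (intro diff_in_L2 scaleR_in_L2 \<rho>)
    have "w r - w t = (r - t) *\<^sub>R (z r + (G - w t))"
      using elim by (simp add: z_def)
    then have "(1 + (t - r)) *\<^sub>R w t = w r + (t - r) *\<^sub>R (G + z r)"
      by (simp add: algebra_simps)
    then have "\<bar>1 + (t - r)\<bar> * norm2 \<rho> (w t) = norm2 \<rho> (w r + (t - r) *\<^sub>R (G + z r))"
      by (metis norm2_scaleR[OF \<rho>])
    also have "\<dots> \<le> norm2 \<rho> (w r) + (t - r) * norm2 \<rho> (G + z r)"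
      using norm2_triangle[OF \<rho> wr, of "(t - r) *\<^sub>R (G + z r)"] elim G z
      by (simp add: norm2_scaleR[OF \<rho>] scaleR_in_L2[OF \<rho>] plus_in_L2[OF \<rho>])
    also have "\<dots> \<le> norm2 \<rho> (w r) + (t - r) * (norm2 \<rho> G + e)"
      using norm2_triangle[OF \<rho> G z] elim by (intro add_left_mono mult_left_mono) auto
    finally show ?case using elim by (simp add: algebra_simps)
  qed
qed

lemma solution_in_L2:
  "weight \<rho> \<Longrightarrow> solution \<rho> J \<beta> g h \<tau> u\<^sub>0 u \<Longrightarrow> \<tau> \<le> t \<Longrightarrow> u t \<in> L2 \<rho>"
  by (rule curve_in_L2[of \<rho> "{\<tau>..}"]) (auto simp: solution_def)

text \<open>
  The derivative of a solution lies in the space by definition, and adding the solution to it leaves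
  the reaction term.
\<close>

lemma solution_reaction_in_L2:
  assumes \<rho>: "weight \<rho>" and u: "solution \<rho> J \<beta> g h \<tau> u\<^sub>0 u" and t: "\<tau> < t"
  shows "reaction J \<beta> g h t (u t) \<in> L2 \<rho>"
proof -
  obtain u' where "continuous_map (top_of_set {\<tau><..}) (top2 \<rho>) u'"
    and u': "u' t = rhs J \<beta> g h t (u t)"
    using u t by (auto simp: solution_def)
  then have "u' t \<in> L2 \<rho>" using curve_in_L2[OF \<rho>, of "{\<tau><..}" u' t] t by auto
  then have "u' t + u t \<in> L2 \<rho>"
    using solution_in_L2[OF \<rho> u] t by (intro plus_in_L2 \<rho>) auto
  then show ?thesis by (simp add: u' rhs_eq_reaction)
qed

lemma solution_deriv:
  assumes "solution \<rho> J \<beta> g h \<tau> u\<^sub>0 u" "\<tau> < t"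
  shows "((\<lambda>r. norm2 \<rho> ((u r - u t) /\<^sub>R (r - t) - (reaction J \<beta> g h t (u t) - u t))) \<longlongrightarrow> 0) (at t)"
  using assms by (auto simp: solution_def rhs_eq_reaction)

text \<open>
  The norm \<open>\<phi>\<close> of a solution satisfies \<open>\<phi>' \<le> - \<phi> + a\<close> in the sense of left difference quotients.
\<close>

lemma solution_norm2_le:
  assumes \<rho>: "weight \<rho>" and J: "conv_kernel J"
    and gm: "g \<in> borel_measurable borel" and hm: "\<And>t. h t \<in> borel_measurable borel"
    and g: "\<And>s. \<bar>g s\<bar> \<le> a"
    and u: "solution \<rho> J \<beta> g h \<tau> u\<^sub>0 u" and t: "\<tau> \<le> t"
  shows "norm2 \<rho> (u t) \<le> norm2 \<rho> u\<^sub>0 * exp (\<tau> - t) + a"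
proof -
  have "0 \<le> a" using g[of 0] by linarith
  have "norm2 \<rho> (u t) \<le> norm2 \<rho> (u \<tau>) * exp (-1 * (t - \<tau>)) + a / -1 * (exp (-1 * (t - \<tau>)) - 1)"
  proof (rule exponential_bound_of_left_growth[OF _ _ _ t])
    have "continuous_map (top_of_set {\<tau>..}) (top2 \<rho>) (\<lambda>_. 0)"
      using zero_in_L2[OF \<rho>] Metric_space.topspace_mtopology[OF Metric_space_L2[OF \<rho>]] by simp
    then show "continuous_on {\<tau>..} (\<lambda>t. norm2 \<rho> (u t))"
      using continuous_on_norm2_diff[OF \<rho>, of "{\<tau>..}" u "\<lambda>_. 0"] u by (simp add: solution_def)
    fix t e :: real assume te: "\<tau> < t" "0 < e"
    let ?G = "reaction J \<beta> g h t (u t)"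
    have G: "?G \<in> L2 \<rho>" by (rule solution_reaction_in_L2[OF \<rho> u te(1)])
    have le: "norm2 \<rho> ?G \<le> a"
      by (rule norm2_reaction_le[OF \<rho> J gm hm g G])
    have "\<forall>\<^sub>F r in at_left t. norm2 \<rho> (u t) \<le> norm2 \<rho> (u r) + (t - r) * (norm2 \<rho> ?G - norm2 \<rho> (u t) + e)"
      by (rule norm2_left_growth[OF \<rho> te(1) solution_in_L2[OF \<rho> u] G solution_deriv[OF u te(1)] te(2)])
    moreover have "\<forall>\<^sub>F r in at_left t. r < t" by (simp add: eventually_at_filter)
    ultimately show "\<forall>\<^sub>F r in at_left t. norm2 \<rho> (u t) \<le> norm2 \<rho> (u r) + (t - r) * (-1 * norm2 \<rho> (u t) + a + e)"
    proof eventually_elim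
      case (elim r)
      have "(t - r) * (norm2 \<rho> ?G - norm2 \<rho> (u t) + e) \<le> (t - r) * (-1 * norm2 \<rho> (u t) + a + e)"
        using elim le by (intro mult_left_mono) auto
      then show ?case using elim by linarith
    qed
  qed simp
  moreover have "u \<tau> = u\<^sub>0" using u by (simp add: solution_def)
  moreover have "0 \<le> a * exp (\<tau> - t)" using \<open>0 \<le> a\<close> by simp
  ultimately show ?thesis by (simp add: algebra_simps)
qed

text \<open>
  The norm \<open>\<phi>\<close> of the difference satisfies \<open>\<phi>' \<le> L \<phi> + c \<eta>\<close> with \<open>c = L / sqrt (K + lh\<^sup>2)\<close>, again in
  the sense of left difference quotients; the damping is dropped, which makes the rate \<open>L\<close>
  positive. Both solutions start at the same point, so that only the term with \<open>\<eta>\<close> is left.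
\<close>

lemma solution_diff_le:
  fixes \<rho> J :: "'a::euclidean_space \<Rightarrow> real"
  assumes \<rho>: "weight \<rho>" and J: "conv_kernel J" and K: "0 < K"
    and doubling: "\<And>x y. norm (x - y) \<le> 1 \<Longrightarrow> \<rho> x \<le> K * \<rho> y"
    and \<beta>: "0 < \<beta>" and lg: "0 < lg" "lg-lipschitz_on UNIV g"
    and meas: "\<And>t. h t \<in> borel_measurable borel" and lip: "\<And>t. lh-lipschitz_on UNIV (h' t)"
    and close: "\<And>t s. \<bar>h t s - h' t s\<bar> \<le> \<eta>"
    and u: "solution \<rho> J \<beta> g h \<tau> u\<^sub>0 u" and v: "solution \<rho> J \<beta> g h' \<tau> u\<^sub>0 v"
    and t: "\<tau> \<le> t"
    and L_def: "L = lg * \<beta> * sqrt 3 * sqrt (K + lh\<^sup>2)"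
  shows "norm2 \<rho> (u t - v t) \<le> \<eta> / sqrt (K + lh\<^sup>2) * (exp (L * (t - \<tau>)) - 1)"
proof -
  have q: "0 < K + lh\<^sup>2" using K by (simp add: add_pos_nonneg)
  have L: "0 < L" using q \<beta> lg by (simp add: L_def)
  define c where "c = lg * \<beta> * sqrt 3"
  let ?w = "\<lambda>t. u t - v t"
  have "norm2 \<rho> (?w t) \<le> norm2 \<rho> (?w \<tau>) * exp (L * (t - \<tau>)) + c * \<eta> / L * (exp (L * (t - \<tau>)) - 1)"
  proof (rule exponential_bound_of_left_growth[OF _ _ _ t])
    show "continuous_on {\<tau>..} (\<lambda>t. norm2 \<rho> (?w t))"
      using continuous_on_norm2_diff[OF \<rho>, of "{\<tau>..}" u v] u v by (simp add: solution_def)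
    fix t e :: real assume te: "\<tau> < t" "0 < e"
    let ?F = "reaction J \<beta> g h t (u t)" and ?G = "reaction J \<beta> g h' t (v t)"
    have FG: "?F \<in> L2 \<rho>" "?G \<in> L2 \<rho>"
      by (rule solution_reaction_in_L2[OF \<rho> u te(1)], rule solution_reaction_in_L2[OF \<rho> v te(1)])
    have in_L2: "u r \<in> L2 \<rho>" "v r \<in> L2 \<rho>" if "\<tau> \<le> r" for r
      using that by (auto intro: solution_in_L2[OF \<rho>] u v)
    have le: "norm2 \<rho> (?F - ?G) \<le> c * (sqrt (K + lh\<^sup>2) * norm2 \<rho> (?w t) + \<eta>)"
      unfolding c_def using K \<beta> te(1)
      by (intro norm2_reaction_diff_le[OF \<rho> J _ doubling _ lg(2) meas lip close _ _ FG] in_L2) auto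
    have deriv: "((\<lambda>r. norm2 \<rho> ((?w r - ?w t) /\<^sub>R (r - t) - ((?F - ?G) - ?w t))) \<longlongrightarrow> 0) (at t)"
    proof (rule tendsto_sandwich[OF _ _ tendsto_const])
      let ?p = "\<lambda>r. (u r - u t) /\<^sub>R (r - t) - (?F - u t)" and ?q = "\<lambda>r. (v r - v t) /\<^sub>R (r - t) - (?G - v t)"
      show "((\<lambda>r. norm2 \<rho> (?p r) + norm2 \<rho> (?q r)) \<longlongrightarrow> 0) (at t)"
        using tendsto_add[OF solution_deriv[OF u te(1)] solution_deriv[OF v te(1)]] by simp
      show "\<forall>\<^sub>F r in at t. 0 \<le> norm2 \<rho> ((?w r - ?w t) /\<^sub>R (r - t) - ((?F - ?G) - ?w t))"
        by (simp add: norm2_nonneg[OF \<rho>])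
      have "\<forall>\<^sub>F r in at t. \<tau> < r"
        using te(1) by (intro order_tendstoD(1)[OF tendsto_ident_at])
      then show "\<forall>\<^sub>F r in at t. norm2 \<rho> ((?w r - ?w t) /\<^sub>R (r - t) - ((?F - ?G) - ?w t))
          \<le> norm2 \<rho> (?p r) + norm2 \<rho> (?q r)"
      proof eventually_elim
        case (elim r)
        have split: "(?w r - ?w t) /\<^sub>R (r - t) - ((?F - ?G) - ?w t) = ?p r - ?q r"
          by (simp add: algebra_simps)
        show ?case
          unfolding split
          using elim te(1) FG by (intro norm2_triangle_diff diff_in_L2 scaleR_in_L2 \<rho> in_L2) auto
      qed
    qed
    have "\<forall>\<^sub>F r in at_left t. norm2 \<rho> (?w t) \<le> norm2 \<rho> (?w r) + (t - r) * (norm2 \<rho> (?F - ?G) - norm2 \<rho> (?w t) + e)"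
      by (rule norm2_left_growth[OF \<rho> te(1) _ _ deriv te(2)])
        (auto intro!: diff_in_L2 \<rho> in_L2 FG)
    moreover have "\<forall>\<^sub>F r in at_left t. r < t" by (simp add: eventually_at_filter)
    ultimately show "\<forall>\<^sub>F r in at_left t. norm2 \<rho> (?w t) \<le> norm2 \<rho> (?w r) + (t - r) * (L * norm2 \<rho> (?w t) + c * \<eta> + e)"
    proof eventually_elim
      case (elim r)
      have "norm2 \<rho> (?F - ?G) \<le> L * norm2 \<rho> (?w t) + c * \<eta>"
        using le by (simp add: L_def c_def algebra_simps)
      then have "(t - r) * (norm2 \<rho> (?F - ?G) - norm2 \<rho> (?w t) + e) \<le> (t - r) * (L * norm2 \<rho> (?w t) + c * \<eta> + e)"
        using elim norm2_nonneg[OF \<rho>, of "?w t"] by (intro mult_left_mono) auto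
      then show ?case using elim by linarith
    qed
  qed (use L in simp)
  moreover have "norm2 \<rho> (?w \<tau>) = 0"
    using u v by (simp add: solution_def norm2_zero[OF \<rho>])
  moreover have "c * \<eta> / L = \<eta> / sqrt (K + lh\<^sup>2)"
    using lg \<beta> by (simp add: c_def L_def)
  ultimately show ?thesis by simp
qed


section \<open>Attractors\<close>

lemma semidist_zero_of_subset:
  assumes \<rho>: "weight \<rho>" and "A \<subseteq> B"
  shows "semidist \<rho> A B = 0"
proof -
  have "(INF b\<in>B. ennreal (norm2 \<rho> (a - b))) \<le> 0" if "a \<in> A" for a
    using that \<open>A \<subseteq> B\<close> by (intro INF_lower2[of a]) (auto simp: norm2_zero[OF \<rho>])
  then have "semidist \<rho> A B \<le> 0"
    unfolding semidist_def by (rule SUP_least)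
  then show ?thesis by simp
qed

text \<open>
  The constant family consisting of this ball is closed and pullback attracts bounded sets, since each
  bounded set has entered the ball by time \<open>t\<close> if it started early enough. Minimality of the
  attractor does the rest.
\<close>

lemma pullback_attractor_subset_ball:
  fixes \<rho> :: "'a::euclidean_space \<Rightarrow> real"
  assumes \<rho>: "weight \<rho>" and J: "conv_kernel J"
    and gm: "g \<in> borel_measurable borel" and hm: "\<And>t. h t \<in> borel_measurable borel"
    and g: "\<And>s. \<bar>g s\<bar> \<le> a"
    and S: "is_process \<rho> J \<beta> g h S" and A: "is_pullback_attractor \<rho> S A"
    and r: "a < r"
  shows "A t \<subseteq> Metric_space.mcball (L2 \<rho>) (dist2 \<rho>) 0 r"
proof -
  interpret Metric_space "L2 \<rho>" "dist2 \<rho>" by (rule Metric_space_L2[OF \<rho>])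
  have dist0: "dist2 \<rho> 0 u = norm2 \<rho> u" for u
    by (simp add: dist2_def norm2_uminus[OF \<rho>])
  have "((\<lambda>\<tau>. semidist \<rho> (S t \<tau> ` C) (mcball 0 r)) \<longlongrightarrow> 0) at_bot" if C: "mbounded C" for C t
  proof (rule tendsto_eventually)
    obtain z R where z: "C \<subseteq> mcball z R" using C unfolding mbounded_def by blast
    define R' where "R' = dist2 \<rho> 0 z + R"
    have R: "u \<in> L2 \<rho> \<and> norm2 \<rho> u \<le> R'" if "u \<in> C" for u
      using that z triangle[of 0 z u] zero_in_L2[OF \<rho>] by (force simp: dist0[symmetric] R'_def)
    have "((\<lambda>\<tau>. R' * exp (- t) * exp \<tau>) \<longlongrightarrow> R' * exp (- t) * 0) at_bot"
      by (intro tendsto_mult tendsto_const exp_at_bot)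
    then have "((\<lambda>\<tau>. R' * exp (\<tau> - t)) \<longlongrightarrow> 0) at_bot"
      by (simp add: exp_diff exp_minus field_simps)
    then have "\<forall>\<^sub>F \<tau> in at_bot. R' * exp (\<tau> - t) < r - a"
      using r by (intro order_tendstoD(2)) auto
    moreover have "\<forall>\<^sub>F \<tau> in at_bot. \<tau> \<le> t" by (rule eventually_le_at_bot)
    ultimately show "\<forall>\<^sub>F \<tau> in at_bot. semidist \<rho> (S t \<tau> ` C) (mcball 0 r) = 0"
    proof eventually_elim
      case (elim \<tau>)
      have "S t \<tau> u \<in> mcball 0 r" if "u \<in> C" for u
      proof -
        have sol: "solution \<rho> J \<beta> g h \<tau> u (\<lambda>t. S t \<tau> u)"
          using S R[OF that] by (auto simp: is_process_def)
        have "norm2 \<rho> (S t \<tau> u) \<le> norm2 \<rho> u * exp (\<tau> - t) + a"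
          by (rule solution_norm2_le[OF \<rho> J gm hm g sol elim(2)])
        also have "\<dots> \<le> R' * exp (\<tau> - t) + a" using R[OF that] by simp
        also have "\<dots> \<le> r" using elim by simp
        finally show ?thesis
          using solution_in_L2[OF \<rho> sol elim(2)] zero_in_L2[OF \<rho>] by (simp add: dist0)
      qed
      then show ?case by (intro semidist_zero_of_subset \<rho>) auto
    qed
  qed
  then have "pullback_attracts_bounded \<rho> S (\<lambda>_. mcball 0 r)"
    by (simp add: pullback_attracts_bounded_def)
  with A show ?thesis
    unfolding is_pullback_attractor_def using closedin_mcball by (metis (no_types, lifting))
qed

lemma ennreal_tendsto_0I:
  fixes f :: "'a \<Rightarrow> ennreal"
  assumes "\<And>e. 0 < e \<Longrightarrow> \<forall>\<^sub>F x in F. f x \<le> ennreal e"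
  shows "(f \<longlongrightarrow> 0) F"
proof (rule order_tendstoI)
  fix c :: ennreal assume "0 < c"
  then obtain d where d: "0 < d" "d < c" using dense by blast
  then obtain e where "d = ennreal e" by (cases d) auto
  with d have e: "0 < e" "ennreal e < c" by auto
  show "\<forall>\<^sub>F x in F. f x < c"
    using assms[OF e(1)] by eventually_elim (use e(2) in auto)
qed simp

theorem theorem6p2:
  fixes \<rho> J :: "real ^ 'n \<Rightarrow> real"
    and g :: "real \<Rightarrow> real"
    and h :: "real \<Rightarrow> real \<Rightarrow> real \<Rightarrow> real"
    and S :: "real \<Rightarrow> real \<Rightarrow> real \<Rightarrow> (real ^ 'n) ae_fun \<Rightarrow> (real ^ 'n) ae_fun"
    and \<A> :: "real \<Rightarrow> real \<Rightarrow> (real ^ 'n) ae_fun set"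
    and \<beta> lg a k1 k2 K :: real
  assumes "weight \<rho>"
    and "\<beta> > 1"
    and "conv_kernel J"
    and "g C1_differentiable_on UNIV" and "g 0 = 0"
    and "lg > 0" and "lg-lipschitz_on UNIV g"
    and "a > 0" and "\<And>s. \<bar>g s\<bar> \<le> a"
    and "k1 > 0" and "k1-lipschitz_on UNIV (deriv g)"
    and "k2 = \<bar>deriv g 0\<bar>" and "k2 > 0"
    and "K > 0" and "\<And>y. (SUP x\<in>{x. norm (x - y) \<le> 1}. \<rho> x) \<le> K * \<rho> y"
    and "\<And>\<epsilon>. \<epsilon> \<in> {0..1} \<Longrightarrow> admissible \<beta> (h \<epsilon>)"
    and "uniform_limit UNIV (\<lambda>\<epsilon> (t, s). h \<epsilon> t s) (\<lambda>(t, s). h 0 t s) (at_right 0)"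
    and "\<And>\<epsilon>. \<epsilon> \<in> {0..1} \<Longrightarrow> is_process \<rho> J \<beta> g (h \<epsilon>) (S \<epsilon>)"
    and "\<And>\<epsilon>. \<epsilon> \<in> {0..1} \<Longrightarrow> is_pullback_attractor \<rho> (S \<epsilon>) (\<A> \<epsilon>)"
  shows "((\<lambda>\<epsilon>. semidist \<rho> (\<A> \<epsilon> t) (\<A> 0 t)) \<longlongrightarrow> 0) (at_right 0)"
proof (rule ennreal_tendsto_0I)
  fix e :: real assume e: "0 < e"
  note \<rho> = assms(1) and J = assms(3)
  note bound = assms(9) and process = assms(18) and attractor = assms(19)
  interpret Metric_space "L2 \<rho>" "dist2 \<rho>" by (rule Metric_space_L2[OF \<rho>])
  have gm: "g \<in> borel_measurable borel"
    using assms(7) by (auto intro!: borel_measurable_continuous_onI dest: lipschitz_on_continuous_on)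
  have hm: "h \<epsilon> t \<in> borel_measurable borel" if "\<epsilon> \<in> {0..1}" for \<epsilon> t
    using assms(16)[OF that]
    by (auto simp: admissible_def intro!: borel_measurable_continuous_onI dest: lipschitz_on_continuous_on)
  obtain lh where lh: "\<And>t. lh-lipschitz_on UNIV (h 0 t)"
    using assms(16)[of 0] by (auto simp: admissible_def)
  \<comment> \<open>continuity bounds the weight on the compact unit ball, so that the real supremum dominates its values there\<close>
  have doubling: "\<rho> x \<le> K * \<rho> y" if "norm (x - y) \<le> 1" for x y
  proof -
    have "compact (\<rho> ` cball y 1)"
      using \<rho> by (intro compact_continuous_image compact_cball)
        (auto simp: weight_def intro: continuous_on_subset)
    moreover have "{x. norm (x - y) \<le> 1} = cball y 1"
      by (auto simp: dist_norm norm_minus_commute)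
    ultimately have "bdd_above (\<rho> ` {x. norm (x - y) \<le> 1})"
      by (simp add: compact_imp_bounded bounded_imp_bdd_above)
    then have "\<rho> x \<le> (SUP x\<in>{x. norm (x - y) \<le> 1}. \<rho> x)"
      using that by (intro cSUP_upper) auto
    then show ?thesis using assms(15)[of y] by linarith
  qed
  \<comment> \<open>one bounded set that contains all the attractors at all times\<close>
  define B where "B = mcball 0 (a + 1)"
  have sub_B: "\<A> \<epsilon> \<tau> \<subseteq> B" if "\<epsilon> \<in> {0..1}" for \<epsilon> \<tau>
    unfolding B_def
    by (rule pullback_attractor_subset_ball[where h = "h \<epsilon>" and S = "S \<epsilon>",
          OF \<rho> J gm hm[OF that] bound process[OF that] attractor[OF that]]) simp
  have "((\<lambda>\<tau>. semidist \<rho> (S 0 t \<tau> ` B) (\<A> 0 t)) \<longlongrightarrow> 0) at_bot"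
    using attractor[of 0] mbounded_mcball
    by (auto simp: B_def is_pullback_attractor_def pullback_attracts_bounded_def)
  then have "\<forall>\<^sub>F \<tau> in at_bot. semidist \<rho> (S 0 t \<tau> ` B) (\<A> 0 t) < ennreal (e / 2)"
    using e by (intro order_tendstoD) auto
  then have "\<forall>\<^sub>F \<tau> in at_bot. semidist \<rho> (S 0 t \<tau> ` B) (\<A> 0 t) < ennreal (e / 2) \<and> \<tau> \<le> t"
    using eventually_le_at_bot[of t] by eventually_elim simp
  then obtain \<tau> where \<tau>: "semidist \<rho> (S 0 t \<tau> ` B) (\<A> 0 t) < ennreal (e / 2)" "\<tau> \<le> t"
    using eventually_happens'[OF trivial_limit_at_bot_linorder] by blast
  define L where "L = lg * \<beta> * sqrt 3 * sqrt (K + lh\<^sup>2)"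
  define M where "M = (exp (L * (t - \<tau>)) - 1) / sqrt (K + lh\<^sup>2)"
  have "0 < K + lh\<^sup>2" using assms(14) by (simp add: add_pos_nonneg)
  then have M: "0 \<le> M"
    using \<tau>(2) assms(2,6) by (auto simp: M_def L_def)
  \<comment> \<open>\<open>M * \<eta>\<close> bounds the distance at time \<open>t\<close> of the two solutions with common data at \<open>\<tau>\<close>;
    the added 1 avoids a division by 0 when \<open>t = \<tau>\<close>\<close>
  define \<eta> where "\<eta> = e / 2 / (M + 1)"
  have \<eta>: "0 < \<eta>" "\<eta> * M \<le> e / 2"
    using M e by (auto simp: \<eta>_def field_simps)
  have "\<forall>\<^sub>F \<epsilon> in at_right 0. \<forall>x\<in>UNIV. dist ((\<lambda>(t, s). h \<epsilon> t s) x) ((\<lambda>(t, s). h 0 t s) x) < \<eta>"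
    using assms(17) \<eta>(1) by (auto simp: uniform_limit_iff)
  moreover have "\<forall>\<^sub>F \<epsilon> in at_right 0. \<epsilon> \<in> {0<..<1::real}"
    by (rule eventually_at_right_real) simp
  ultimately show "\<forall>\<^sub>F \<epsilon> in at_right 0. semidist \<rho> (\<A> \<epsilon> t) (\<A> 0 t) \<le> ennreal e"
  proof eventually_elim
    case (elim \<epsilon>)
    then have \<epsilon>: "\<epsilon> \<in> {0..1}" by auto
    have close: "\<bar>h \<epsilon> t s - h 0 t s\<bar> \<le> \<eta>" for t s
      using bspec[OF elim(1), of "(t, s)"] by (simp add: dist_real_def)
    show ?case
      unfolding semidist_def
    proof (rule SUP_least)
      fix b assume "b \<in> \<A> \<epsilon> t"
      moreover have "S \<epsilon> t \<tau> ` \<A> \<epsilon> \<tau> = \<A> \<epsilon> t"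
        using attractor[OF \<epsilon>] \<tau>(2) by (auto simp: is_pullback_attractor_def)
      ultimately obtain u where u: "u \<in> \<A> \<epsilon> \<tau>" "b = S \<epsilon> t \<tau> u" by blast
      have uB: "u \<in> B" using sub_B[OF \<epsilon>] u(1) by blast
      then have uL2: "u \<in> L2 \<rho>" by (simp add: B_def)
      define v where "v = S 0 t \<tau> u"
      have sol: "solution \<rho> J \<beta> g (h \<epsilon>) \<tau> u (\<lambda>t. S \<epsilon> t \<tau> u)"
        "solution \<rho> J \<beta> g (h 0) \<tau> u (\<lambda>t. S 0 t \<tau> u)"
        using process[OF \<epsilon>] process[of 0] uL2 by (auto simp: is_process_def)
      have bv: "b \<in> L2 \<rho>" "v \<in> L2 \<rho>"
        using solution_in_L2[OF \<rho> _ \<tau>(2)] sol by (auto simp: u v_def)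
      have "norm2 \<rho> (b - v) \<le> \<eta> / sqrt (K + lh\<^sup>2) * (exp (L * (t - \<tau>)) - 1)"
        unfolding u(2) v_def
        by (rule solution_diff_le[OF \<rho> J assms(14) doubling _ assms(6,7) hm[OF \<epsilon>] lh close sol \<tau>(2) L_def])
          (use assms(2) in auto)
      also have "\<dots> = \<eta> * M" by (simp add: M_def)
      finally have bv_close: "dist2 \<rho> b v \<le> e / 2"
        using \<eta>(2) by (simp add: dist2_def)
      have "(INF y\<in>\<A> 0 t. ennreal (norm2 \<rho> (v - y))) \<le> semidist \<rho> (S 0 t \<tau> ` B) (\<A> 0 t)"
        unfolding semidist_def v_def using uB by (intro SUP_upper) auto
      then have "(INF y\<in>\<A> 0 t. ennreal (norm2 \<rho> (v - y))) < ennreal (e / 2)"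
        using \<tau>(1) by (rule le_less_trans)
      then obtain y where y: "y \<in> \<A> 0 t" "dist2 \<rho> v y < e / 2"
        using norm2_nonneg[OF \<rho>] by (auto simp: INF_less_iff ennreal_less_iff dist2_def)
      have "y \<in> B" using sub_B[of 0] y(1) by auto
      then have "y \<in> L2 \<rho>" by (simp add: B_def)
      then have "dist2 \<rho> b y \<le> e"
        using triangle[of b v y] bv bv_close y(2) by simp
      then show "(INF y\<in>\<A> 0 t. ennreal (norm2 \<rho> (b - y))) \<le> ennreal e"
        using y(1) by (intro INF_lower2) (auto simp: dist2_def intro: ennreal_leI)
    qed
  qed
qed

end
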